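(* Let $n\ge2$ and $\nu>-1$. Then $\bigcup_{1<q\le\infty}B_q^{0,\nu}(\mathbb{S}^{n-1})$ is a proper subspace of $L(\log^+L)^{1+\nu}(\mathbb{S}^{n-1})$.
   Context: $\mathbb{S}^{n-1}$ is the unit sphere of $\mathbb{R}^n$ and $\sigma$ is the induced Lebesgue (surface) measure; $|M|=\sigma(M)$. Functions are complex-valued and identified when equal a.e. $\log^+t=\max\{\log t,0\}$ for $t>0$, $\log^+0=0$. A cap is a set $\{x\in\mathbb{S}^{n-1}:|x-x_0|<\rho\}$ with $x_0\in\mathbb{S}^{n-1}$, $\rho>0$ (an arc when $n=2$). For $1<q\le\infty$ let $1/q+1/q'=1$ (so $q'=1$ if $q=\infty$). A $q$-block is a measurable function $a$ on $\mathbb{S}^{n-1}$ supported in some cap $M$ with $\|a\|_{q}\le |M|^{-1/q'}$. The block space $B_q^{0,\nu}(\mathbb{S}^{n-1})$ is the set of all $\Omega\in L^1(\mathbb{S}^{n-1})$ that can be written as $\Omega=\sum_{j=1}^\infty\mu_ja_j$ (convergence in $L^1$), where $\mu_j\in\mathbb{C}$, each $a_j$ is a $q$-block supported in a cap $M_j$, and $$\sum_{j=1}^\infty|\mu_j|\Big\{1+\Big(\log^+\frac1{|M_j|}\Big)^{1+\nu}\Big\}<\infty.$$ For $\beta>0$, $L(\log^+L)^\beta(\mathbb{S}^{n-1})$ is the set of measurable $f$ with $f\in L^1(\mathbb{S}^{n-1})$ and $\int_{\mathbb{S}^{n-1}}|f|(\log^+|f|)^\beta d\sigma<\infty$ (equivalently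 $\int|f|(\log(e+|f|))^\beta d\sigma<\infty$). *)

theory Defs
  imports
    "HOL-Analysis.Analysis"
    "HOL-Probability.Essential_Supremum"
    "HOL-Library.Function_Algebras"
begin

text \<open>
  Surface measure on the unit sphere, given by the polar-coordinates formula
  \<open>\<sigma>(A) = n * vol {t x | x \<in> A, 0 < t < 1}\<close> for Borel sets \<open>A\<close>, and then completed. It is
  obtained as \<open>n\<close> times the image of Lebesgue measure on the punctured unit ball under the
  radial projection \<open>x / \<bar>x\<bar>\<close>; see \<open>emeasure_sphere_measure\<close>.
\<close>

definition borel_sphere_measure :: "(real ^ 'n) measure" where
  "borel_sphere_measure =
     scale_measure (of_nat CARD('n))
       (distr (restrict_space lborel (ball 0 1 - {0})) (restrict_space borel (sphere 0 1))
          (\<lambda>x. x /\<^sub>R norm x))"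

definition sphere_measure :: "(real ^ 'n) measure" where
  "sphere_measure = completion borel_sphere_measure"

lemma radial_projection_measurable:
  "(\<lambda>x::real ^ 'n. x /\<^sub>R norm x)
     \<in> measurable (restrict_space lborel (ball 0 1 - {0})) (restrict_space borel (sphere 0 1))"
proof (rule measurable_restrict_space2)
  show "(\<lambda>x::real ^ 'n. x /\<^sub>R norm x)
      \<in> space (restrict_space lborel (ball 0 1 - {0})) \<rightarrow> sphere 0 1"
    by (auto simp: space_restrict_space)
  show "(\<lambda>x::real ^ 'n. x /\<^sub>R norm x) \<in> borel_measurable (restrict_space lborel (ball 0 1 - {0}))"
    by (rule measurable_restrict_space1) measurable
qed

lemma emeasure_sphere_measure:
  fixes A :: "(real ^ 'n) set"
  assumes "A \<in> sets borel" "A \<subseteq> sphere 0 1"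
  shows "emeasure sphere_measure A =
    of_nat CARD('n) * emeasure lborel {t *\<^sub>R x | t x. x \<in> A \<and> 0 < t \<and> t < 1}"
proof -
  let ?M = "restrict_space lborel (ball 0 1 - {0}) :: (real ^ 'n) measure"
  have A: "A \<in> sets (restrict_space borel (sphere 0 1))"
    using assms by (auto simp: sets_restrict_space image_iff)
  have "(\<lambda>x. x /\<^sub>R norm x) -` A \<inter> (ball 0 1 - {0}) =
      {t *\<^sub>R x | t x. x \<in> A \<and> 0 < t \<and> t < 1}" (is "?L = ?R")
  proof (intro set_eqI iffI)
    fix y assume y: "y \<in> ?L"
    then have "y = norm y *\<^sub>R (y /\<^sub>R norm y)" "0 < norm y" "norm y < 1" "y /\<^sub>R norm y \<in> A"
      by auto
    then show "y \<in> ?R" by blast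
  next
    fix y assume "y \<in> ?R"
    then obtain t x where "y = t *\<^sub>R x" "x \<in> A" "0 < t" "t < 1" by blast
    moreover have "norm x = 1" using assms(2) \<open>x \<in> A\<close> by auto
    ultimately show "y \<in> ?L" by auto
  qed
  moreover have "emeasure sphere_measure A = emeasure borel_sphere_measure A"
    unfolding sphere_measure_def
    by (rule emeasure_completion[THEN trans])
       (use A in \<open>auto simp: borel_sphere_measure_def main_part_sets\<close>)
  moreover have "emeasure (distr ?M (restrict_space borel (sphere 0 1)) (\<lambda>x. x /\<^sub>R norm x)) A =
      emeasure ?M ((\<lambda>x. x /\<^sub>R norm x) -` A \<inter> (ball 0 1 - {0}))"
    by (subst emeasure_distr[OF radial_projection_measurable A]) (simp add: space_restrict_space)
  moreover have "\<dots> = emeasure lborel ((\<lambda>x. x /\<^sub>R norm x) -` A \<inter> (ball 0 1 - {0}))"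
    by (rule emeasure_restrict_space) auto
  ultimately show ?thesis
    by (simp add: borel_sphere_measure_def)
qed

definition cap :: "real ^ 'n \<Rightarrow> real \<Rightarrow> (real ^ 'n) set" where
  "cap x\<^sub>0 \<rho> = {x \<in> sphere 0 1. norm (x - x\<^sub>0) < \<rho>}"

definition is_cap :: "(real ^ 'n) set \<Rightarrow> bool" where
  "is_cap M \<longleftrightarrow> (\<exists>x\<^sub>0 \<in> sphere 0 1. \<exists>\<rho> > 0. M = cap x\<^sub>0 \<rho>)"

definition log_plus :: "real \<Rightarrow> real" where
  "log_plus t = (if t = 0 then 0 else max (ln t) 0)"

text \<open>The exponent ranges over the extended half-line \<open>[1, \<infinity>]\<close>, so the norm may be infinite.\<close>

definition Lq_norm :: "'a measure \<Rightarrow> ennreal \<Rightarrow> ('a \<Rightarrow> complex) \<Rightarrow> ennreal" where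
  "Lq_norm M q f =
     (if q = \<infinity> then esssup M (\<lambda>x. ennreal (cmod (f x)))
      else let I = (\<integral>\<^sup>+ x. ennreal (cmod (f x) powr enn2real q) \<partial>M)
           in if I = \<infinity> then \<infinity> else ennreal (enn2real I powr (1 / enn2real q)))"

text \<open>For \<open>1 < q \<le> \<infinity>\<close> this is the solution of \<open>1/q + 1/q' = 1\<close>, with \<open>1/\<infinity> = 0\<close>.\<close>

definition conjugate_exponent :: "ennreal \<Rightarrow> real" where
  "conjugate_exponent q = (if q = \<infinity> then 1 else enn2real q / (enn2real q - 1))"

text \<open>
  Functions are total on \<open>\<real>\<^sup>n\<close>, but only their values on the sphere, the space of
  \<open>sphere_measure\<close>, are relevant. The support condition is imposed almost everywhere, in accordance
  with the identification of functions that are equal almost everywhere.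
\<close>

definition is_block :: "ennreal \<Rightarrow> (real ^ 'n) set \<Rightarrow> (real ^ 'n \<Rightarrow> complex) \<Rightarrow> bool" where
  "is_block q M a \<longleftrightarrow>
     is_cap M \<and> a \<in> borel_measurable sphere_measure \<and>
     (AE x in sphere_measure. x \<notin> M \<longrightarrow> a x = 0) \<and>
     Lq_norm sphere_measure q a
       \<le> ennreal (measure sphere_measure M powr (- 1 / conjugate_exponent q))"

text \<open>
  The function spaces are sets of representatives; they are closed under almost everywhere
  equality, so inclusions and linear structure are those of the spaces of equivalence classes.
\<close>

definition block_space :: "ennreal \<Rightarrow> real \<Rightarrow> (real ^ 'n \<Rightarrow> complex) set" where
  "block_space q \<nu> =
     {\<Omega>. integrable sphere_measure \<Omega> \<and>
        (\<exists>(\<mu> :: nat \<Rightarrow> complex) (a :: nat \<Rightarrow> real ^ 'n \<Rightarrow> complex) (M :: nat \<Rightarrow> (real ^ 'n) set).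
           (\<forall>j. is_block q (M j) (a j)) \<and>
           (\<lambda>N. Lq_norm sphere_measure 1 (\<lambda>x. \<Omega> x - (\<Sum>j<N. \<mu> j * a j x))) \<longlonglongrightarrow> 0 \<and>
           summable (\<lambda>j. cmod (\<mu> j) *
             (1 + log_plus (1 / measure sphere_measure (M j)) powr (1 + \<nu>))))}"

definition L_log_L :: "real \<Rightarrow> (real ^ 'n \<Rightarrow> complex) set" where
  "L_log_L \<beta> =
     {f. integrable sphere_measure f \<and>
        (\<integral>\<^sup>+ x. ennreal (cmod (f x) * log_plus (cmod (f x)) powr \<beta>) \<partial>sphere_measure) < \<infinity>}"

abbreviation function_subspace :: "('a \<Rightarrow> complex) set \<Rightarrow> bool" where
  "function_subspace \<equiv> module.subspace (\<lambda>(c::complex) f x. c * f x)"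

lemma function_subspace_iff:
  "function_subspace S \<longleftrightarrow>
     (\<lambda>x. 0) \<in> S \<and> (\<forall>f\<in>S. \<forall>g\<in>S. (\<lambda>x. f x + g x) \<in> S) \<and> (\<forall>c. \<forall>f\<in>S. (\<lambda>x. c * f x) \<in> S)"
proof -
  interpret module "\<lambda>(c::complex) (f::'a \<Rightarrow> complex) x. c * f x"
    by unfold_locales (auto simp: fun_eq_iff algebra_simps)
  show ?thesis by (simp add: subspace_def plus_fun_def zero_fun_def)
qed

definition proper_subspace :: "('a \<Rightarrow> complex) set \<Rightarrow> ('a \<Rightarrow> complex) set \<Rightarrow> bool" where
  "proper_subspace U V \<longleftrightarrow> function_subspace U \<and> function_subspace V \<and> U \<subset> V"

end

(*
  For the inclusion, dominate |Omega| by the sum of |mu_j| |a_j| and integrate each |a_j| against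
  (log^+ |Omega|)^beta: where |Omega| <= |M_j|^(-2) this factor is at most (2 log^+ (1/|M_j|))^beta,
  and elsewhere Young's inequality absorbs it into |a_j|^q and |Omega|. The geometry of the supports
  plays no role here.

  For properness, choose sets E_k of relative measure 2^(-k) spread so uniformly that they have
  density at most 3 * 2^(-k) in every cap that is not absurdly small. The function
  f = sum_k c_k 1_{E_k} / |E_k|, with c_k decaying like a power of k, lies in L (log^+ L)^beta by the
  inclusion argument with M_j = E_j. If f were a series of q-blocks, large caps would contribute to
  the integral of f over E_k at most a fixed power of 2^(-k) by the exponent q > 1, and small caps at
  most 2^(-k) because of their logarithmic weight. Hence c_k would decay exponentially.
*)

theory Submission
  imports Defs "HOL-Probability.Distribution_Functions"
begin

section \<open>Surface measure and caps\<close>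

text \<open>The order of choices shapes the properness argument: one function has to escape the
  block spaces for all exponents at once, so the sets and coefficients may not depend on q. An
  assumed block series yields a bound of order t^s with t = 2^(-k) and s > 0 depending on q, and
  polynomially decaying coefficients contradict every such s. With \<beta> = 1 + \<nu>, a cap counts
  as small below measure exp(-t^(-1/\<beta>)): there the weight (log (1/|M|))^\<beta> is at least
  1/t, which pays for the factor that spreading would have given. The sets must be spread in all
  larger caps, an infinite family. It reduces to a finite one because caps have null boundaries and
  so vary continuously with centre and radius. Null hyperplane slices also allow sets of any
  prescribed proportion; they are where n >= 2 enters. Every q in (1, infinity] can be lowered to a
  real exponent at the cost of a factor 2, so one integral inequality describes all blocks.\<close>

lemma space_sphere_measure [simp]: "space sphere_measure = sphere 0 1"
  by (simp add: sphere_measure_def borel_sphere_measure_def space_restrict_space space_scale_measure)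

lemma sphere_measure_setsI:
  "A \<in> sets borel \<Longrightarrow> A \<subseteq> sphere 0 1 \<Longrightarrow> A \<in> sets sphere_measure"
  unfolding sphere_measure_def
  by (rule sets_completionI_sets)
     (auto simp: borel_sphere_measure_def sets_restrict_space image_iff)

lemma sphere_measure_CollectI:
  assumes "Measurable.pred borel P"
  shows "{x \<in> sphere 0 1. P x} \<in> sets sphere_measure"
proof (rule sphere_measure_setsI)
  have "{x \<in> sphere 0 1. P x} = sphere 0 1 \<inter> {x \<in> space borel. P x}" by auto
  also have "\<dots> \<in> sets borel" using assms by (intro sets.Int) auto
  finally show "{x \<in> sphere 0 1. P x} \<in> sets borel" .
qed auto

lemma sphere_measure_measurableI:
  assumes "f \<in> borel_measurable borel"
  shows "f \<in> borel_measurable (sphere_measure :: (real ^ 'n) measure)"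
proof -
  have "f \<in> borel_measurable (restrict_space borel (sphere 0 1))"
    using assms by (rule measurable_restrict_space1)
  then have "f \<in> borel_measurable (borel_sphere_measure :: (real ^ 'n) measure)"
    by (subst measurable_cong_sets[of _ "restrict_space borel (sphere 0 1)" borel borel])
       (auto simp: borel_sphere_measure_def)
  then show ?thesis
    unfolding sphere_measure_def by (rule measurable_completion)
qed

text \<open>The right-hand side is a preimage under the radial projection, the form in which
  openness and measurability of a cone can be read off.\<close>

lemma cone_eq:
  assumes "A \<subseteq> sphere 0 1"
  shows "{t *\<^sub>R x | t x. x \<in> A \<and> 0 < t \<and> t < 1} =
    {y \<in> ball 0 1 - {0}. y /\<^sub>R norm y \<in> A}"
proof (intro set_eqI iffI)
  fix y assume "y \<in> {t *\<^sub>R x | t x. x \<in> A \<and> 0 < t \<and> t < 1}"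
  then obtain t x where "y = t *\<^sub>R x" "x \<in> A" "0 < t" "t < 1" by blast
  moreover have "norm x = 1" using assms \<open>x \<in> A\<close> by auto
  ultimately show "y \<in> {y \<in> ball 0 1 - {0}. y /\<^sub>R norm y \<in> A}" by auto
next
  fix y assume y: "y \<in> {y \<in> ball 0 1 - {0}. y /\<^sub>R norm y \<in> A}"
  then have "y = norm y *\<^sub>R (y /\<^sub>R norm y)" "0 < norm y" "norm y < 1" "y /\<^sub>R norm y \<in> A"
    by auto
  then show "y \<in> {t *\<^sub>R x | t x. x \<in> A \<and> 0 < t \<and> t < 1}" by blast
qed

lemma emeasure_sphere_finite: "emeasure sphere_measure (sphere 0 1 :: (real ^ 'n) set) < \<infinity>"
proof -
  have "emeasure lborel {t *\<^sub>R x | t x. x \<in> (sphere 0 1 :: (real ^ 'n) set) \<and> 0 < t \<and> t < 1}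
      \<le> emeasure lborel (ball (0 :: real ^ 'n) 1)"
    by (subst cone_eq) (auto intro!: emeasure_mono)
  also have "\<dots> < \<infinity>" by (rule emeasure_lborel_ball_finite)
  finally show ?thesis
    by (subst emeasure_sphere_measure) (auto simp: ennreal_mult_less_top of_nat_less_top)
qed

interpretation sphere: finite_measure "sphere_measure :: (real ^ 'n) measure"
  by (rule finite_measureI) (use emeasure_sphere_finite in \<open>auto simp: less_top\<close>)

lemma cap_in_borel: "cap x\<^sub>0 \<rho> \<in> sets borel"
proof -
  have "cap x\<^sub>0 \<rho> = sphere 0 1 \<inter> ball x\<^sub>0 \<rho>"
    by (auto simp: cap_def dist_norm norm_minus_commute)
  then show ?thesis by simp
qed

lemma cap_in_sets: "cap x\<^sub>0 \<rho> \<in> sets sphere_measure"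
  by (rule sphere_measure_setsI[OF cap_in_borel]) (auto simp: cap_def)

lemma is_cap_in_sets: "is_cap M \<Longrightarrow> M \<in> sets sphere_measure"
  by (auto simp: is_cap_def cap_in_sets)

text \<open>The cone over a cap is open and nonempty, so it has positive volume. This keeps
  reciprocals and negative powers of cap measures away from their default value 0 at 0.\<close>

lemma sphere_measure_cap_pos:
  assumes "is_cap M"
  shows "measure sphere_measure M > 0"
proof -
  obtain x\<^sub>0 \<rho> where x: "norm x\<^sub>0 = 1" "\<rho> > 0" and M: "M = cap x\<^sub>0 \<rho>"
    using assms by (auto simp: is_cap_def)
  have MS: "M \<subseteq> sphere 0 1" by (auto simp: M cap_def)
  have MB: "M \<in> sets borel" by (simp add: M cap_in_borel)
  let ?C = "{y \<in> ball 0 1 - {0}. y /\<^sub>R norm y \<in> M}"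
  have C: "?C = {y \<in> ball 0 1 - {0}. y /\<^sub>R norm y \<in> ball x\<^sub>0 \<rho>}"
    by (auto simp: M cap_def dist_norm norm_minus_commute)
  have "open {y \<in> ball 0 1 - {0}. y /\<^sub>R norm y \<in> ball x\<^sub>0 \<rho>}"
    using continuous_open_preimage[of "ball 0 1 - {0}" "\<lambda>y. y /\<^sub>R norm y" "ball x\<^sub>0 \<rho>"]
    by (simp add: Int_def vimage_def open_Diff conj_assoc continuous_intros)
  then have op: "open ?C" by (simp only: C)
  have "(1/2) *\<^sub>R x\<^sub>0 \<in> ?C" unfolding C using x by auto
  then have "\<not> negligible ?C" by (intro open_not_negligible[OF op]) blast
  then have "?C \<notin> null_sets lebesgue" by (simp only: negligible_iff_null_sets not_False_eq_True)
  moreover have "?C \<in> sets lborel" using op by (simp only: sets_lborel borel_open)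
  ultimately have "?C \<notin> null_sets lborel" using null_sets_completionI by blast
  then have "emeasure lborel ?C \<noteq> 0" using \<open>?C \<in> sets lborel\<close> by blast
  then have "emeasure sphere_measure M \<noteq> 0"
    by (subst emeasure_sphere_measure[OF MB MS]) (simp add: cone_eq[OF MS])
  then show ?thesis
    by (simp add: sphere.emeasure_eq_measure zero_less_measure_iff)
qed

section \<open>Null slices of the sphere\<close>

text \<open>Infinitely many disjoint translates of \<open>A\<close> have equal measure and fit into
  one bounded set, whose measure is finite.\<close>

lemma emeasure_lborel_eq_0_if_translates_disjoint:
  fixes A :: "'a :: euclidean_space set"
  assumes A: "A \<in> sets borel" "bounded A"
    and disj: "\<And>y s. y \<in> A \<Longrightarrow> s \<noteq> 0 \<Longrightarrow> y + s *\<^sub>R v \<notin> A"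
  shows "emeasure lborel A = 0"
proof -
  \<comment> \<open>Distinct shifts in (0, 1], so that all translates stay within
    \<open>norm v\<close> of \<open>A\<close>.\<close>
  define s where "s k = inverse (real (Suc k))" for k :: nat
  define B where "B k = (\<lambda>y. s k *\<^sub>R v + y) -` A" for k
  have B: "B k \<in> sets borel" for k
    unfolding B_def using A by (intro measurable_sets_borel[where M = borel]) auto
  have eq: "emeasure lborel (B k) = emeasure lborel A" for k
  proof -
    have "emeasure lborel A = emeasure (distr lborel borel ((+) (s k *\<^sub>R v))) A"
      by (simp add: lborel_distr_plus)
    also have "\<dots> = emeasure lborel (B k)"
      using A by (subst emeasure_distr) (auto simp: B_def)
    finally show ?thesis by simp
  qed
  have "disjoint_family B"
    unfolding disjoint_family_on_def
  proof (intro ballI impI)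
    fix j k :: nat assume "j \<noteq> k"
    then have ne: "s k - s j \<noteq> 0" by (simp add: s_def)
    show "B j \<inter> B k = {}"
    proof (rule ccontr)
      assume "B j \<inter> B k \<noteq> {}"
      then obtain y where "s j *\<^sub>R v + y \<in> A" "s k *\<^sub>R v + y \<in> A" by (auto simp: B_def)
      then show False using disj[of "s j *\<^sub>R v + y" "s k - s j"] ne
        by (simp add: algebra_simps)
    qed
  qed
  then have "(\<Sum>k. emeasure lborel (B k)) = emeasure lborel (\<Union>k. B k)"
    using B by (intro suminf_emeasure) auto
  also have "\<dots> < \<infinity>"
  proof (rule emeasure_bounded_finite)
    obtain K where K: "\<And>y. y \<in> A \<Longrightarrow> norm y \<le> K" using A(2) by (auto simp: bounded_iff)
    have "norm y \<le> K + norm v" if y: "y \<in> B k" for y k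
    proof -
      have "norm y \<le> norm (s k *\<^sub>R v + y) + norm (s k *\<^sub>R v)"
        by (metis add.commute norm_triangle_sub norm_minus_commute add_diff_cancel_left' norm_triangle_ineq4)
      moreover have "norm (s k *\<^sub>R v + y) \<le> K" using y K by (auto simp: B_def)
      moreover have "norm (s k *\<^sub>R v) \<le> norm v"
        by (auto simp: s_def intro!: mult_left_le_one_le) (simp add: field_simps)
      ultimately show ?thesis by linarith
    qed
    then show "bounded (\<Union>k. B k)" by (auto simp: bounded_iff)
  qed
  finally have fin: "(\<Sum>k::nat. emeasure lborel A) < \<infinity>" by (simp add: eq)
  show ?thesis
  proof (rule ccontr)
    assume nz: "emeasure lborel A \<noteq> 0"
    have le: "of_nat N * emeasure lborel A \<le> (\<Sum>k::nat. emeasure lborel A)" for N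
      using sum_le_suminf[of "\<lambda>k::nat. emeasure lborel A" "{..<N}"] by simp
    obtain l where l: "(\<Sum>k::nat. emeasure lborel A) = ennreal l" "l \<ge> 0"
      using fin by (cases "\<Sum>k::nat. emeasure lborel A") auto
    obtain r where r: "emeasure lborel A = ennreal r" "r > 0"
      using emeasure_bounded_finite[OF A(2)] nz
      by (cases "emeasure lborel A") (auto simp: order_less_le)
    obtain N :: nat where "real N * r > l" using ex_less_of_nat_mult[OF r(2)] by blast
    then show False using le[of N] l r
      by (simp add: ennreal_of_nat_eq_real_of_nat flip: ennreal_mult)
  qed
qed

text \<open>The cone over the slice is the surface y . e = t |y| in the punctured unit ball. If |t|
  < 1, a shift by s along e changes y . e by s but t |y| by at most |t| |s|, so translates are
  disjoint. If |t| >= 1, equality in Cauchy-Schwarz puts the cone on the line of e, which lies in a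
  hyperplane because n >= 2. On the two-point sphere of dimension one the claim fails.\<close>

lemma sphere_measure_inner_slice_null:
  fixes e :: "real ^ 'n"
  assumes n: "CARD('n) \<ge> 2" and e: "norm e = 1"
  shows "emeasure sphere_measure {x \<in> sphere 0 1. x \<bullet> e = t} = 0"
proof -
  let ?S = "{x \<in> sphere 0 1. x \<bullet> e = t}"
  define A where "A = {y \<in> ball 0 1 - {0}. y \<bullet> e = t * norm y}"
  have "?S = sphere 0 1 \<inter> ((\<lambda>x. x \<bullet> e) -` {t} \<inter> space borel)" by auto
  moreover have "\<dots> \<in> sets borel"
    by (intro sets.Int measurable_sets[of _ borel borel]) auto
  ultimately have SB: "?S \<in> sets borel" by simp
  have C: "{t *\<^sub>R x | t x. x \<in> ?S \<and> 0 < t \<and> t < 1} = A"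
    by (subst cone_eq) (auto simp: A_def field_simps)
  have AB: "A \<in> sets borel" unfolding A_def by measurable
  have Ab: "bounded A" unfolding A_def by (rule bounded_subset[OF bounded_ball[of 0 1]]) auto
  have "emeasure lborel A = 0"
  proof (cases "\<bar>t\<bar> < 1")
    case True
    show ?thesis
    proof (rule emeasure_lborel_eq_0_if_translates_disjoint[OF AB Ab, of e])
      fix y s assume y: "y \<in> A" and s: "(s::real) \<noteq> 0"
      show "y + s *\<^sub>R e \<notin> A"
      proof
        assume "y + s *\<^sub>R e \<in> A"
        then have "y \<bullet> e + s = t * norm (y + s *\<^sub>R e)"
          using e by (simp add: A_def inner_add_left dot_square_norm)
        then have "s = t * (norm (y + s *\<^sub>R e) - norm y)"
          using y by (simp add: A_def algebra_simps)
        then have "\<bar>s\<bar> = \<bar>t\<bar> * \<bar>norm (y + s *\<^sub>R e) - norm y\<bar>" by (metis abs_mult)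
        also have "\<dots> \<le> \<bar>t\<bar> * \<bar>s\<bar>"
          using norm_triangle_ineq3[of "y + s *\<^sub>R e" y] e by (intro mult_left_mono) auto
        also have "\<dots> < 1 * \<bar>s\<bar>" using True s by (intro mult_strict_right_mono) auto
        finally show False by simp
      qed
    qed
  next
    case False
    obtain w where w: "w \<noteq> 0" "orthogonal e w"
      by (rule orthogonal_to_vector_exists[of e]) (use n in auto)
    have we: "w \<bullet> e = 0" using w by (simp add: orthogonal_def inner_commute)
    have "w \<bullet> y = 0" if y: "y \<in> A" for y
    proof -
      have "\<bar>y \<bullet> e\<bar> = \<bar>t\<bar> * norm y" using y by (simp add: A_def abs_mult)
      also have "\<dots> \<ge> 1 * norm y" using False by (intro mult_right_mono) auto
      finally have "\<bar>y \<bullet> e\<bar> = norm y * norm e"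
        using Cauchy_Schwarz_ineq2[of y e] e by simp
      then have "norm y *\<^sub>R e = y \<or> norm y *\<^sub>R e = - y"
        using e unfolding norm_cauchy_schwarz_abs_eq by (auto simp: minus_equation_iff)
      then have "y = norm y *\<^sub>R e \<or> y = - (norm y *\<^sub>R e)" by (metis minus_minus)
      then show ?thesis using we by (metis inner_minus_right inner_scaleR_right minus_zero mult_zero_right)
    qed
    then have "A \<subseteq> {y. w \<bullet> y = 0}" by auto
    then have "negligible A" using negligible_hyperplane[of w 0] w negligible_subset by blast
    then have "emeasure lebesgue A = 0" by (simp add: negligible_iff_null_sets null_setsD1)
    then show ?thesis using AB by simp
  qed
  then show ?thesis
    by (subst emeasure_sphere_measure[OF SB], blast, subst C) simp
qed

section \<open>Uniformly spread sets\<close>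

text \<open>The distribution function of \<open>g\<close> on \<open>P\<close> is continuous because
  level sets are null, so it attains the intermediate value t |P|. The set is a sublevel set of
  \<open>g\<close> in \<open>P\<close>.\<close>

lemma (in finite_measure) ex_subset_of_proportion:
  fixes g :: "'a \<Rightarrow> real"
  assumes g: "g \<in> borel_measurable M" and null: "\<And>s. measure M {x \<in> space M. g x = s} = 0"
    and P: "P \<in> sets M" and t: "0 \<le> t" "t \<le> 1"
  shows "\<exists>E \<in> sets M. E \<subseteq> P \<and> measure M E = t * measure M P"
\<comment> \<open>Here t |P| lies strictly between the limits 0 and |P| of the distribution
  function, which provides finite endpoints for the intermediate value theorem.\<close>
proof (cases "0 < t * measure M P \<and> t < 1")
  case False
  then have "t * measure M P = 0 \<or> t = 1"
    using t mult_nonneg_nonneg[OF t(1) measure_nonneg[of M P]] by linarith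
  then show ?thesis
  proof
    assume "t * measure M P = 0"
    then show ?thesis by (intro bexI[of _ "{}"]) auto
  next
    assume "t = 1"
    then show ?thesis using P by (intro bexI[of _ P]) auto
  qed
next
  case True
  then have pos: "0 < t" "t < 1" "0 < measure M P"
    using t zero_less_mult_iff[of t "measure M P"] by auto
  define N where "N = distr (restrict_space M P) borel g"
  have gP: "g \<in> borel_measurable (restrict_space M P)" by (rule measurable_restrict_space1[OF g])
  have PS: "P \<subseteq> space M" using P sets.sets_into_space by blast
  have sp: "space (restrict_space M P) = P" using PS by (auto simp: space_restrict_space)
  have N: "measure N B = measure M (g -` B \<inter> P)" if "B \<in> sets borel" for B
  proof -
    have "measure N B = measure (restrict_space M P) (g -` B \<inter> P)"
      unfolding N_def by (subst measure_distr[OF gP that]) (simp add: sp)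
    then show ?thesis using P by (subst (asm) measure_restrict_space) auto
  qed
  have "finite_measure (restrict_space M P)"
    using P by (intro finite_measureI) (simp add: sp emeasure_restrict_space)
  then interpret N: finite_borel_measure N
    unfolding N_def by (intro finite_borel_measure.intro finite_measure.finite_measure_distr gP
      finite_borel_measure_axioms.intro) auto
  have "measure N {s} = 0" for s
  proof -
    have "measure N {s} \<le> measure M {x \<in> space M. g x = s}"
      using PS g by (subst N) (auto intro!: finite_measure_mono)
    then show ?thesis using null[of s] measure_nonneg[of N "{s}"] by simp
  qed
  then have cont: "isCont (cdf N) s" for s by (simp add: N.isCont_cdf)
  have tot: "measure N (space N) = measure M P" by (simp add: N.borel_UNIV N)
  have "\<forall>\<^sub>F i in sequentially. t * measure M P < cdf N (real i)"
    using N.cdf_lim_infty pos by (intro order_tendstoD(1)) (auto simp: tot)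
  then obtain b :: nat where b: "t * measure M P < cdf N (real b)"
    using eventually_happens'[OF sequentially_bot] by blast
  have "\<forall>\<^sub>F i in sequentially. cdf N (- real i) < t * measure M P"
    using N.cdf_lim_neg_infty pos by (intro order_tendstoD(2)) auto
  then obtain a :: nat where a: "cdf N (- real a) < t * measure M P"
    using eventually_happens'[OF sequentially_bot] by blast
  obtain s where "cdf N s = t * measure M P"
    using IVT[of "cdf N" "- real a" "t * measure M P" "real b"] a b cont by auto
  then have "measure M (g -` {..s} \<inter> P) = t * measure M P" by (simp add: cdf_def N)
  moreover have "g -` {..s} \<inter> P \<in> sets M"
  proof -
    have "g -` {..s} \<inter> P = (g -` {..s} \<inter> space M) \<inter> P" using PS by auto
    then show ?thesis using P measurable_sets[OF g, of "{..s}"] by auto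
  qed
  ultimately show ?thesis by blast
qed

text \<open>The set is assembled atom by atom from the finite algebra generated by the family.\<close>

lemma (in finite_measure) ex_uniform_subset_finite_family:
  fixes t :: real
  assumes ex: "\<And>P. P \<in> sets M \<Longrightarrow> \<exists>E \<in> sets M. E \<subseteq> P \<and> measure M E = t * measure M P"
    and F: "finite F" "F \<subseteq> sets M"
  shows "\<exists>E \<in> sets M. \<forall>P \<in> F. measure M (E \<inter> P) = t * measure M P"
proof -
  \<comment> \<open>Atoms, indexed by the exact set of members of \<open>F\<close> that contain a
    point; \<open>Q A\<close> is empty unless \<open>A\<close> is a subset of
    \<open>F\<close>.\<close>
  define Q where "Q A = {x \<in> space M. {P \<in> F. x \<in> P} = A}" for A
  have Q: "Q A \<in> sets M" for A
  proof (cases "A \<subseteq> F")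
    case True
    then have "Q A = {x \<in> space M. (\<forall>P \<in> F. x \<in> P \<longleftrightarrow> P \<in> A)}" by (auto simp: Q_def)
    also have "\<dots> \<in> sets M"
    proof (rule sets.sets_Collect_finite_All[OF _ F(1)])
      fix P assume "P \<in> F"
      then have P: "P \<in> sets M" using F by blast
      then have "{x \<in> space M. x \<in> P \<longleftrightarrow> P \<in> A} = (if P \<in> A then P else space M - P)"
        using sets.sets_into_space by auto
      then show "{x \<in> space M. x \<in> P \<longleftrightarrow> P \<in> A} \<in> sets M" using P by simp
    qed
    finally show ?thesis .
  next
    case False
    then have "Q A = {}" by (auto simp: Q_def)
    then show ?thesis by simp
  qed
  have "\<forall>A. \<exists>E. E \<in> sets M \<and> E \<subseteq> Q A \<and> measure M E = t * measure M (Q A)"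
    using ex[OF Q] by blast
  then have "\<exists>E. \<forall>A. E A \<in> sets M \<and> E A \<subseteq> Q A \<and> measure M (E A) = t * measure M (Q A)"
    by (rule choice)
  then obtain E where E: "\<And>A. E A \<in> sets M" "\<And>A. E A \<subseteq> Q A"
    "\<And>A. measure M (E A) = t * measure M (Q A)" by blast
  define U where "U = (\<Union>A \<in> Pow F. E A)"
  have "measure M (U \<inter> P) = t * measure M P" if P: "P \<in> F" for P
  proof -
    define I where "I = {A \<in> Pow F. P \<in> A}"
    have I: "finite I" using F by (simp add: I_def)
    have dQ: "disjoint_family_on Q I" by (auto simp: disjoint_family_on_def Q_def)
    have dE: "disjoint_family_on E I"
      using dQ E(2) unfolding disjoint_family_on_def by blast
    have PM: "P \<subseteq> space M" using P F sets.sets_into_space by blast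
    have PQ: "P = (\<Union>A \<in> I. Q A)"
    proof (intro set_eqI iffI)
      fix x assume "x \<in> P"
      then have "x \<in> Q {P \<in> F. x \<in> P}" "{P \<in> F. x \<in> P} \<in> I"
        using PM P by (auto simp: Q_def I_def)
      then show "x \<in> (\<Union>A \<in> I. Q A)" by blast
    next
      fix x assume "x \<in> (\<Union>A \<in> I. Q A)"
      then show "x \<in> P" by (auto simp: I_def Q_def)
    qed
    have UE: "U \<inter> P = (\<Union>A \<in> I. E A)"
    proof (intro set_eqI iffI)
      fix x assume "x \<in> U \<inter> P"
      then obtain A where A: "A \<in> Pow F" "x \<in> E A" "x \<in> P" by (auto simp: U_def)
      then have "P \<in> A" using E(2)[of A] P by (auto simp: Q_def)
      then show "x \<in> (\<Union>A \<in> I. E A)" using A by (auto simp: I_def)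
    next
      fix x assume "x \<in> (\<Union>A \<in> I. E A)"
      then obtain A where A: "A \<in> Pow F" "P \<in> A" "x \<in> E A" by (auto simp: I_def)
      then have "x \<in> P" using E(2)[of A] by (auto simp: Q_def)
      then show "x \<in> U \<inter> P" using A by (auto simp: U_def)
    qed
    have "measure M (U \<inter> P) = (\<Sum>A\<in>I. measure M (E A))"
      unfolding UE using I E dE by (intro finite_measure_finite_Union) auto
    also have "\<dots> = t * (\<Sum>A\<in>I. measure M (Q A))" by (simp add: E(3) sum_distrib_left)
    also have "(\<Sum>A\<in>I. measure M (Q A)) = measure M (\<Union>A \<in> I. Q A)"
      using I Q dQ by (intro finite_measure_finite_Union[symmetric]) auto
    also have "\<dots> = measure M P" using PQ by simp
    finally show ?thesis .
  qed
  moreover have "U \<in> sets M" unfolding U_def using F E by (intro sets.finite_UN) auto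
  ultimately show ?thesis by blast
qed

section \<open>Approximation of caps by a finite family\<close>

text \<open>By polarization, distance and inner product determine each other on unit vectors; hence
  the boundary of a cap lies in a hyperplane slice.\<close>

lemma inner_eq_if_dist_eq:
  fixes x y :: "'a :: real_inner"
  assumes "norm x = 1" "norm y = 1" "norm (x - y) = \<rho>"
  shows "x \<bullet> y = 1 - \<rho>\<^sup>2 / 2"
  using assms by (simp add: dot_norm_neg)

text \<open>Centres and radii range over a compact set. Two caps with close parameters disagree only
  in a thin shell about one boundary, and such shells shrink to a null slice.\<close>

lemma caps_totally_bounded:
  assumes n: "CARD('n) \<ge> 2" and \<eta>: "\<eta> > 0"
  shows "\<exists>F. finite F \<and> F \<subseteq> sets (sphere_measure :: (real ^ 'n) measure) \<and>
    (\<forall>M. is_cap M \<longrightarrow> (\<exists>P \<in> F. measure sphere_measure (M - P) < \<eta> \<and> measure sphere_measure (P - M) < \<eta>))"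
proof -
  \<comment> \<open>The shell of half-width \<open>r\<close> about the boundary of the cap with
    centre \<open>fst z\<close> and radius \<open>snd z\<close>.\<close>
  define D where "D z r = {x \<in> sphere 0 1. \<bar>norm (x - fst z) - snd z\<bar> \<le> r}"
    for z :: "(real ^ 'n) \<times> real" and r
  have DS: "D z r \<in> sets sphere_measure" for z r
    unfolding D_def by (rule sphere_measure_CollectI) measurable
  \<comment> \<open>Unit vectors are at distance at most 2, so every radius from 3 on gives the
    whole sphere. Radius 0 is included for compactness; its set is empty, but members of
    \<open>F\<close> need not be caps.\<close>
  define K where "K = sphere (0 :: real ^ 'n) 1 \<times> {0..3::real}"
  have ex: "\<exists>r>0. measure sphere_measure (D z r) < \<eta>" if z: "z \<in> K" for z
  proof -
    let ?D = "\<lambda>m::nat. D z (inverse (real (Suc m)))"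
    have "(\<lambda>m. measure sphere_measure (?D m)) \<longlonglongrightarrow> measure sphere_measure (\<Inter>m. ?D m)"
    proof (rule sphere.finite_Lim_measure_decseq)
      show "range ?D \<subseteq> sets sphere_measure" using DS by blast
      show "decseq ?D"
        unfolding decseq_Suc_iff
      proof
        fix m
        have "inverse (real (Suc (Suc m))) \<le> inverse (real (Suc m))" by (simp add: field_simps)
        then show "?D (Suc m) \<subseteq> ?D m" unfolding D_def by (auto intro: order_trans simp del: of_nat_Suc)
      qed
    qed
    moreover have "measure sphere_measure (\<Inter>m. ?D m) = 0"
    proof -
      have "(\<Inter>m. ?D m) \<subseteq> {x \<in> sphere 0 1. x \<bullet> fst z = 1 - (snd z)\<^sup>2 / 2}"
      proof
        fix x assume x: "x \<in> (\<Inter>m. ?D m)"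
        then have 1: "norm x = 1" by (auto simp: D_def)
        have "\<bar>norm (x - fst z) - snd z\<bar> \<le> inverse (real (Suc m))" for m
          using x unfolding D_def by blast
        then have "\<bar>norm (x - fst z) - snd z\<bar> \<le> 0"
          using LIMSEQ_le_const[OF LIMSEQ_inverse_real_of_nat] by blast
        then show "x \<in> {x \<in> sphere 0 1. x \<bullet> fst z = 1 - (snd z)\<^sup>2 / 2}"
          using 1 z by (auto simp: K_def intro!: inner_eq_if_dist_eq)
      qed
      moreover have "{x \<in> sphere 0 1. x \<bullet> fst z = 1 - (snd z)\<^sup>2 / 2} \<in> sets sphere_measure"
        by (rule sphere_measure_CollectI) measurable
      ultimately have "measure sphere_measure (\<Inter>m. ?D m) \<le>
          measure sphere_measure {x \<in> sphere 0 1. x \<bullet> fst z = 1 - (snd z)\<^sup>2 / 2}"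
        by (rule sphere.finite_measure_mono)
      also have "\<dots> = 0"
        using sphere_measure_inner_slice_null[OF n, of "fst z"] z
        by (auto simp: K_def measure_def)
      finally show ?thesis using measure_nonneg by (metis order_antisym)
    qed
    ultimately have "\<forall>\<^sub>F m in sequentially. measure sphere_measure (?D m) < \<eta>"
      using \<eta> by (intro order_tendstoD(2)) auto
    then obtain m where "measure sphere_measure (?D m) < \<eta>"
      using eventually_happens'[OF sequentially_bot] by blast
    then show ?thesis by (intro exI[of _ "inverse (real (Suc m))"]) auto
  qed
  have "\<exists>r. \<forall>z\<in>K. r z > 0 \<and> measure sphere_measure (D z (r z)) < \<eta>"
    using bchoice[of K "\<lambda>z r. r > 0 \<and> measure sphere_measure (D z r) < \<eta>"] ex by blast
  then obtain r where r: "\<And>z. z \<in> K \<Longrightarrow> r z > 0"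
    "\<And>z. z \<in> K \<Longrightarrow> measure sphere_measure (D z (r z)) < \<eta>" by blast
  have "compact K" unfolding K_def by (intro compact_Times) auto
  \<comment> \<open>Half radii, because the errors in centre and in radius add up: each is below
    \<open>r z / 2\<close>, so the disagreement stays in the shell of half-width
    \<open>r z\<close>.\<close>
  moreover have "K \<subseteq> (\<Union>z\<in>K. ball z (r z / 2))"
  proof
    fix z assume "z \<in> K"
    then show "z \<in> (\<Union>z\<in>K. ball z (r z / 2))" using r(1)[of z] by (intro UN_I[of z]) auto
  qed
  ultimately obtain Z where Z: "Z \<subseteq> K" "finite Z" "K \<subseteq> (\<Union>z\<in>Z. ball z (r z / 2))"
    using compactE_image[of K K "\<lambda>z. ball z (r z / 2)", OF _ open_ball] by blast
  have "\<exists>P \<in> (\<lambda>z. cap (fst z) (snd z)) ` Z.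
      measure sphere_measure (M - P) < \<eta> \<and> measure sphere_measure (P - M) < \<eta>"
    if M: "is_cap M" for M
  proof -
    obtain x\<^sub>0 \<rho>' where x: "norm x\<^sub>0 = 1" "\<rho>' > 0" "M = cap x\<^sub>0 \<rho>'"
      using M by (auto simp: is_cap_def)
    define \<rho> where "\<rho> = min \<rho>' 3"
    have "norm (x - x\<^sub>0) < 3" if "norm x = 1" for x
      using norm_triangle_ineq4[of x x\<^sub>0] that x by simp
    then have M\<rho>: "M = cap x\<^sub>0 \<rho>" by (auto simp: x cap_def \<rho>_def)
    have "(x\<^sub>0, \<rho>) \<in> K" using x by (auto simp: K_def \<rho>_def)
    then obtain z where z: "z \<in> Z" "dist z (x\<^sub>0, \<rho>) < r z / 2" using Z by auto
    have d1: "norm (fst z - x\<^sub>0) < r z / 2"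
      using dist_fst_le[of z "(x\<^sub>0, \<rho>)"] z by (simp add: dist_norm)
    have d2: "\<bar>snd z - \<rho>\<bar> < r z / 2"
      using dist_snd_le[of z "(x\<^sub>0, \<rho>)"] z by (simp add: dist_norm)
    have close: "\<bar>norm (x - x\<^sub>0) - norm (x - fst z)\<bar> < r z / 2" for x
      using norm_triangle_ineq3[of "x - x\<^sub>0" "x - fst z"] d1 by simp
    have sub: "x \<in> D z (r z)" if "x \<in> M \<longleftrightarrow> x \<notin> cap (fst z) (snd z)" "norm x = 1" for x
    proof -
      have "norm (x - x\<^sub>0) < \<rho> \<longleftrightarrow> \<not> norm (x - fst z) < snd z"
        using that by (simp add: M\<rho> cap_def)
      then have "\<bar>norm (x - fst z) - snd z\<bar> \<le> r z" using close[of x] d2 by linarith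
      then show ?thesis using that by (simp add: D_def)
    qed
    have "M - cap (fst z) (snd z) \<subseteq> D z (r z)" "cap (fst z) (snd z) - M \<subseteq> D z (r z)"
      by (auto intro!: sub simp: M\<rho> cap_def)
    then have le: "measure sphere_measure (M - cap (fst z) (snd z)) \<le> measure sphere_measure (D z (r z))"
      "measure sphere_measure (cap (fst z) (snd z) - M) \<le> measure sphere_measure (D z (r z))"
      using DS by (blast intro: sphere.finite_measure_mono)+
    have "measure sphere_measure (D z (r z)) < \<eta>" using r Z z by blast
    then show ?thesis using z(1) le by (intro bexI[of _ "cap (fst z) (snd z)"]) auto
  qed
  then show ?thesis using Z(2)
    by (intro exI[of _ "(\<lambda>z. cap (fst z) (snd z)) ` Z"] conjI allI impI)
      (simp, use cap_in_sets in blast, blast)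
qed

text \<open>Compare \<open>M\<close> with a member \<open>P\<close> of the finite family, where
  \<open>E\<close> has density exactly \<open>t\<close>. The factor 3 collects t |M|, the excess t
  |P - M| and the error |M - P|; the tolerance \<open>t * \<delta>\<close> makes each of the last
  two at most t |M|.\<close>

lemma ex_spread_subset:
  fixes t \<delta> :: real
  assumes n: "CARD('n) \<ge> 2" and t: "0 < t" "t \<le> 1" and \<delta>: "\<delta> > 0"
  shows "\<exists>E \<in> sets (sphere_measure :: (real ^ 'n) measure).
    measure sphere_measure E = t * measure sphere_measure (sphere 0 1 :: (real ^ 'n) set) \<and>
    (\<forall>M. is_cap M \<and> measure sphere_measure M \<ge> \<delta> \<longrightarrow>
      measure sphere_measure (E \<inter> M) \<le> 3 * t * measure sphere_measure M)"
proof -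
  have "t * \<delta> > 0" using t \<delta> by simp
  from caps_totally_bounded[OF n this] obtain F
    where F: "finite F" "F \<subseteq> sets (sphere_measure :: (real ^ 'n) measure)"
      and approx: "\<And>M. is_cap M \<Longrightarrow> \<exists>P \<in> F. measure sphere_measure (M - P) < t * \<delta> \<and>
        measure sphere_measure (P - M) < t * \<delta>" by blast
  obtain e :: "real ^ 'n" where e: "norm e = 1" using vector_choose_size[of 1] by auto
  have "\<exists>E \<in> sets sphere_measure. E \<subseteq> P \<and> measure sphere_measure E = t * measure sphere_measure P"
    if "P \<in> sets (sphere_measure :: (real ^ 'n) measure)" for P
  \<comment> \<open>Slices orthogonal to \<open>e\<close> carry no mass, so the coordinate along
    \<open>e\<close> can cut off any proportion.\<close>
  proof (rule sphere.ex_subset_of_proportion[where g = "\<lambda>x. x \<bullet> e"])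
    show "measure sphere_measure {x \<in> space sphere_measure. x \<bullet> e = s} = 0" for s
      using sphere_measure_inner_slice_null[OF n e, of s] by (simp add: measure_def)
  qed (use t that in \<open>auto intro!: sphere_measure_measurableI\<close>)
  \<comment> \<open>The whole sphere joins the family in order to fix the measure of
    \<open>E\<close> itself.\<close>
  from sphere.ex_uniform_subset_finite_family[OF this, of "insert (sphere 0 1) F"] F
  obtain E where E: "E \<in> sets sphere_measure"
    and u: "\<And>P. P \<in> insert (sphere 0 1) F \<Longrightarrow> measure sphere_measure (E \<inter> P) = t * measure sphere_measure P"
    using sets.top[of sphere_measure] by (auto simp del: sets.top)
  have "measure sphere_measure (E \<inter> M) \<le> 3 * t * measure sphere_measure M"
    if M: "is_cap M" "measure sphere_measure M \<ge> \<delta>" for M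
  proof -
    obtain P where P: "P \<in> F" "measure sphere_measure (M - P) < t * \<delta>"
        "measure sphere_measure (P - M) < t * \<delta>"
      using approx M by blast
    have s: "P \<in> sets sphere_measure" "M \<in> sets sphere_measure"
      using P F M is_cap_in_sets by auto
    have "measure sphere_measure (E \<inter> M) \<le> measure sphere_measure ((E \<inter> P) \<union> (M - P))"
      using s E by (intro sphere.finite_measure_mono) auto
    also have "\<dots> \<le> measure sphere_measure (E \<inter> P) + measure sphere_measure (M - P)"
      using s E by (intro measure_subadditive) (auto simp: sphere.emeasure_eq_measure)
    also have "\<dots> \<le> t * measure sphere_measure P + t * \<delta>" using u P by auto
    finally have 1: "measure sphere_measure (E \<inter> M) \<le> t * measure sphere_measure P + t * \<delta>" .
    have "measure sphere_measure P \<le> measure sphere_measure (M \<union> (P - M))"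
      using s by (intro sphere.finite_measure_mono) auto
    also have "\<dots> \<le> measure sphere_measure M + measure sphere_measure (P - M)"
      using s by (intro measure_subadditive) (auto simp: sphere.emeasure_eq_measure)
    also have "\<dots> \<le> measure sphere_measure M + t * \<delta>" using P by simp
    also have "t * \<delta> \<le> 1 * measure sphere_measure M" using M t \<delta> by (intro mult_mono) auto
    finally have "t * measure sphere_measure P \<le> t * (2 * measure sphere_measure M)"
      using t by (intro mult_left_mono) auto
    moreover have "t * \<delta> \<le> t * measure sphere_measure M" using M t by (intro mult_left_mono) auto
    ultimately show ?thesis using 1 by simp
  qed
  moreover have "E \<inter> sphere 0 1 = E" using sets.sets_into_space[OF E] by auto
  ultimately show ?thesis using E u[of "sphere 0 1"] by auto
qed

section \<open>Logarithmic integrability of block series\<close>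

lemma log_plus_nonneg [simp]: "0 \<le> log_plus t"
  by (simp add: log_plus_def)

lemma log_plus_eq_ln: "1 \<le> t \<Longrightarrow> log_plus t = ln t"
  by (simp add: log_plus_def)

lemma log_plus_eq_0: "0 \<le> t \<Longrightarrow> t \<le> 1 \<Longrightarrow> log_plus t = 0"
  by (auto simp: log_plus_def max_def ln_le_zero_iff)

lemma log_plus_mono:
  assumes "0 \<le> s" "s \<le> t"
  shows "log_plus s \<le> log_plus t"
proof (cases "s \<le> 1")
  case False
  then show ?thesis using assms by (simp add: log_plus_eq_ln)
qed (simp add: log_plus_eq_0 assms)

lemma log_plus_mult_le:
  assumes "0 \<le> s" "0 \<le> t"
  shows "log_plus (s * t) \<le> log_plus s + log_plus t"
proof (cases "s \<le> 1 \<or> t \<le> 1")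
  case True
  then have "s * t \<le> t \<or> s * t \<le> s"
    using assms mult_left_le_one_le mult_right_le_one_le by blast
  then have "log_plus (s * t) \<le> log_plus t \<or> log_plus (s * t) \<le> log_plus s"
    using assms by (metis log_plus_mono mult_nonneg_nonneg)
  then show ?thesis using log_plus_nonneg[of s] log_plus_nonneg[of t] by linarith
next
  case False
  then have "1 * 1 \<le> s * t" by (intro mult_mono) auto
  then show ?thesis using False by (simp add: log_plus_eq_ln ln_mult)
qed

lemma log_plus_measurable [measurable]: "log_plus \<in> borel_measurable borel"
  unfolding log_plus_def by measurable

text \<open>Comparison with twice the maximum covers all exponents at once, also those below 1,
  where the power is concave.\<close>

lemma add_powr_le:
  fixes x y \<beta> :: real
  assumes "0 \<le> x" "0 \<le> y" "0 \<le> \<beta>"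
  shows "(x + y) powr \<beta> \<le> 2 powr \<beta> * (x powr \<beta> + y powr \<beta>)"
proof -
  have "(x + y) powr \<beta> \<le> (2 * max x y) powr \<beta>" using assms by (intro powr_mono2) auto
  also have "\<dots> = 2 powr \<beta> * max x y powr \<beta>" using assms by (simp add: powr_mult)
  also have "\<dots> \<le> 2 powr \<beta> * (x powr \<beta> + y powr \<beta>)"
    by (intro mult_left_mono) (auto simp: max_def)
  finally show ?thesis .
qed

lemma log_plus_powr_le_sqrt:
  assumes "p > 0"
  shows "\<exists>C\<ge>0. \<forall>u\<ge>1. log_plus u powr p \<le> C * sqrt u"
proof (intro exI conjI allI impI)
  fix u :: real assume u: "1 \<le> u"
  \<comment> \<open>This exponent turns (u^a)^p into u^(1/2), with constant (1/a)^p = (2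
    p)^p.\<close>
  define a where "a = 1 / (2 * p)"
  have a: "a > 0" using assms by (simp add: a_def)
  have "log_plus u powr p \<le> (u powr a / a) powr p"
    using ln_powr_bound[OF u a] assms u by (intro powr_mono2) (auto simp: log_plus_eq_ln)
  also have "\<dots> = (2 * p) powr p * sqrt u"
    using u assms by (simp add: powr_divide powr_powr a_def powr_half_sqrt powr_mult)
  finally show "log_plus u powr p \<le> (2 * p) powr p * sqrt u" .
qed simp

text \<open>Young's inequality with constants 1: if g <= b^(q-1), the first power alone dominates
  the product, and otherwise the second does.\<close>

lemma mult_le_powr_add_powr:
  fixes b g q :: real
  assumes "0 \<le> b" "0 \<le> g" "1 < q"
  shows "b * g \<le> b powr q + g powr (q / (q - 1))"
proof (cases "g \<le> b powr (q - 1)")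
  case True
  have "b * g \<le> b * b powr (q - 1)" using True assms by (intro mult_left_mono) auto
  also have "\<dots> = b powr q" using assms by (cases "b = 0") (auto simp: powr_mult_base)
  finally show ?thesis by (simp add: add_increasing2)
next
  case False
  then have "(b powr (q - 1)) powr (1 / (q - 1)) \<le> g powr (1 / (q - 1))"
    using assms by (intro powr_mono2) auto
  then have "b \<le> g powr (1 / (q - 1))" using assms by (simp add: powr_powr)
  then have "b * g \<le> g powr (1 / (q - 1)) * g" using assms by (intro mult_right_mono) auto
  also have "\<dots> = g powr (1 + 1 / (q - 1))" using assms by (cases "g = 0") (auto simp: powr_mult_base mult.commute)
  also have "1 + 1 / (q - 1) = q / (q - 1)" using assms by (simp add: field_simps)
  finally show ?thesis by (simp add: add_increasing)
qed

text \<open>Above the level \<open>l\<close>, the negative power b^(1-q) is at most l^(1-q). The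
  level stays free so that the two terms can be balanced later.\<close>

lemma le_add_mult_powr:
  fixes b l q :: real
  assumes "0 \<le> b" "0 < l" "1 < q"
  shows "b \<le> l + l powr (1 - q) * b powr q"
proof (cases "b \<le> l")
  case True
  then show ?thesis by (simp add: add_increasing2)
next
  case False
  have "b = b powr (1 - q) * b powr q" using False assms by (simp add: flip: powr_add)
  also have "\<dots> \<le> l powr (1 - q) * b powr q"
    using False assms by (intro mult_right_mono powr_mono2') auto
  finally show ?thesis using assms by linarith
qed

text \<open>
  If \<open>u\<close> is at most \<open>m\<^sup>-\<^sup>2\<close>, its logarithm is controlled by that of \<open>1/m\<close>; otherwise every power of
  the logarithm is absorbed by \<open>sqrt u \<le> m * u\<close>.
\<close>

lemma mult_log_plus_powr_le:
  fixes \<beta> q :: real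
  assumes "\<beta> > 0" "q > 1"
  shows "\<exists>C\<ge>0. \<forall>m>0. \<forall>a\<ge>0. \<forall>u\<ge>0. a * log_plus u powr \<beta> \<le>
    a * (2 * log_plus (1 / m)) powr \<beta> + (m * a) powr q / m + C * u"
proof -
  \<comment> \<open>The power of the logarithm that results from the conjugate exponent q/(q-1) in
    Young's inequality.\<close>
  define p where "p = \<beta> * (q / (q - 1))"
  have "p > 0" using assms by (simp add: p_def)
  then obtain C where C: "C \<ge> 0" "\<And>u. u \<ge> 1 \<Longrightarrow> log_plus u powr p \<le> C * sqrt u"
    using log_plus_powr_le_sqrt by blast
  have "a * log_plus u powr \<beta> \<le>
      a * (2 * log_plus (1 / m)) powr \<beta> + (m * a) powr q / m + C * u"
    if m: "m > 0" and a: "a \<ge> 0" and u: "u \<ge> 0" for m a u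
  proof -
    have nn: "0 \<le> a * (2 * log_plus (1 / m)) powr \<beta>" "0 \<le> (m * a) powr q / m" "0 \<le> C * u"
      using m a u C by auto
    consider "u \<le> 1" | "1 < u" "u \<le> (1 / m)\<^sup>2" | "1 < u" "(1 / m)\<^sup>2 < u" by linarith
    then show ?thesis
    proof cases
      case 1
      then show ?thesis using nn u by (simp add: log_plus_eq_0)
    next
      case 2
      then have "1 < (1 / m)\<^sup>2" by linarith
      then have "1 < 1 / m" using m by (metis less_eq_real_def not_less power_le_one zero_less_divide_1_iff)
      moreover have "ln u \<le> ln ((1 / m)\<^sup>2)" using 2 m by (subst ln_le_cancel_iff) auto
      ultimately have "log_plus u \<le> 2 * log_plus (1 / m)"
        using 2 by (simp add: log_plus_eq_ln ln_realpow)
      then have "a * log_plus u powr \<beta> \<le> a * (2 * log_plus (1 / m)) powr \<beta>"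
        using assms a by (intro mult_left_mono powr_mono2) auto
      then show ?thesis using nn by linarith
    next
      case 3
      have "1 / m < sqrt u" using 3 m by (intro real_less_rsqrt) auto
      then have "1 \<le> m * sqrt u" using m by (simp add: field_simps)
      then have "1 * sqrt u \<le> m * sqrt u * sqrt u" using 3 by (intro mult_right_mono) auto
      then have su: "sqrt u \<le> m * u" using 3 by (simp add: mult.assoc)
      \<comment> \<open>Young is applied to \<open>m * a\<close> rather than \<open>a\<close>:
        division by \<open>m\<close> then leaves the normalized power term and cancels the factor
        from \<open>su\<close>, so \<open>C\<close> does not depend on \<open>m\<close>.\<close>
      have "m * a * log_plus u powr \<beta> \<le> (m * a) powr q + (log_plus u powr \<beta>) powr (q / (q - 1))"
        using m a assms by (intro mult_le_powr_add_powr) auto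
      also have "(log_plus u powr \<beta>) powr (q / (q - 1)) = log_plus u powr p"
        by (simp add: powr_powr p_def)
      also have "\<dots> \<le> C * (m * u)"
        using C(2)[of u] 3 mult_left_mono[OF su C(1)] by linarith
      finally have "a * log_plus u powr \<beta> \<le> (m * a) powr q / m + C * u"
        using m by (simp add: field_simps)
      then show ?thesis using nn by linarith
    qed
  qed
  then show ?thesis using C by blast
qed

section \<open>Normalized blocks on finite measure spaces\<close>

text \<open>
  For a real exponent \<open>q > 1\<close> the block condition \<open>\<parallel>a\<parallel>\<^sub>q \<le> |B| powr (1/q - 1)\<close>, raised to the power \<open>q\<close>.
  The support \<open>B\<close> need not be a cap here.
\<close>

definition normalized_block :: "'a measure \<Rightarrow> real \<Rightarrow> 'a set \<Rightarrow> ('a \<Rightarrow> complex) \<Rightarrow> bool" where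
  "normalized_block M q B a \<longleftrightarrow>
     B \<in> sets M \<and> 0 < measure M B \<and> a \<in> borel_measurable M \<and> (AE x in M. x \<notin> B \<longrightarrow> a x = 0) \<and>
     (\<integral>\<^sup>+ x. ennreal ((measure M B * cmod (a x)) powr q) \<partial>M) \<le> ennreal (measure M B)"

text \<open>This is \<open>le_add_mult_powr\<close> for m |a|, divided by m and integrated over
  \<open>E\<close>: values up to level \<open>l\<close> are charged to the part of \<open>E\<close>
  in the support, larger ones to the power integral.\<close>

lemma (in finite_measure) nn_integral_normalized_block_on:
  assumes b: "normalized_block M q B a" and q: "q > 1" and E: "E \<in> sets M" and l: "l > 0"
  shows "(\<integral>\<^sup>+ x. ennreal (cmod (a x)) * indicator E x \<partial>M) \<le>
    ennreal (l * measure M (E \<inter> B) / measure M B + l powr (1 - q))"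
proof -
  define m where "m = measure M B"
  have B: "B \<in> sets M" "m > 0" "AE x in M. x \<notin> B \<longrightarrow> a x = 0"
      "(\<integral>\<^sup>+ x. ennreal ((m * cmod (a x)) powr q) \<partial>M) \<le> ennreal m"
    and [measurable]: "a \<in> borel_measurable M"
    using b by (auto simp: normalized_block_def m_def)
  have "(\<integral>\<^sup>+ x. ennreal (cmod (a x)) * indicator E x \<partial>M) \<le>
      (\<integral>\<^sup>+ x. ennreal (l / m) * indicator (E \<inter> B) x +
        ennreal (l powr (1 - q) / m) * ennreal ((m * cmod (a x)) powr q) \<partial>M)"
  proof (rule nn_integral_mono_AE)
    show "AE x in M. ennreal (cmod (a x)) * indicator E x \<le> ennreal (l / m) * indicator (E \<inter> B) x +
        ennreal (l powr (1 - q) / m) * ennreal ((m * cmod (a x)) powr q)"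
      using B(3)
    proof eventually_elim
      case (elim x)
      show ?case
      proof (cases "x \<in> E \<inter> B")
        case True
        have "m * cmod (a x) \<le> l + l powr (1 - q) * (m * cmod (a x)) powr q"
          using B(2) l q by (intro le_add_mult_powr) auto
        then have "cmod (a x) \<le> l / m + l powr (1 - q) / m * (m * cmod (a x)) powr q"
          using B(2) by (simp add: field_simps)
        then show ?thesis using True B(2) l
          by (simp flip: ennreal_mult ennreal_plus)
      next
        case False
        then show ?thesis using elim by (cases "x \<in> E") auto
      qed
    qed
  qed
  also have "\<dots> = ennreal (l / m) * ennreal (measure M (E \<inter> B)) +
      ennreal (l powr (1 - q) / m) * (\<integral>\<^sup>+ x. ennreal ((m * cmod (a x)) powr q) \<partial>M)"
    using E B(1) by (simp add: nn_integral_add nn_integral_cmult emeasure_eq_measure)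
  also have "\<dots> \<le> ennreal (l / m) * ennreal (measure M (E \<inter> B)) + ennreal (l powr (1 - q) / m) * ennreal m"
    using B(4) by (intro add_left_mono mult_left_mono) auto
  also have "\<dots> = ennreal (l * measure M (E \<inter> B) / m + l powr (1 - q))"
    using B(2) l by (simp flip: ennreal_mult ennreal_plus)
  finally show ?thesis by (simp add: m_def)
qed

lemma (in finite_measure) nn_integral_normalized_block:
  assumes b: "normalized_block M q B a" and q: "q > 1"
  shows "(\<integral>\<^sup>+ x. ennreal (cmod (a x)) \<partial>M) \<le> 2"
proof -
  have B: "B \<in> sets M" "measure M B > 0" using b by (auto simp: normalized_block_def)
  then have "space M \<inter> B = B" using sets.sets_into_space by blast
  \<comment> \<open>At level 1 on the whole space, each of the two terms equals 1.\<close>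
  then have "(\<integral>\<^sup>+ x. ennreal (cmod (a x)) * indicator (space M) x \<partial>M) \<le> ennreal 2"
    using nn_integral_normalized_block_on[OF b q sets.top, of 1] B by simp
  then show ?thesis by (simp cong: nn_integral_cong)
qed

text \<open>The estimate is not circular: the term C u of the pointwise bound integrates to C times
  the L^1 norm of \<open>\<Omega>\<close>, which is finite by assumption. Each block thus costs its
  own weight times a factor independent of \<open>j\<close>.\<close>

lemma (in finite_measure) nn_integral_log_plus_powr_finite:
  fixes \<Omega> :: "'a \<Rightarrow> complex" and \<mu> :: "nat \<Rightarrow> complex"
  assumes \<beta>: "\<beta> > 0" and q: "q > 1" and int: "integrable M \<Omega>"
    and b: "\<And>j. normalized_block M q (B j) (a j)"
    and dom: "AE x in M. ennreal (cmod (\<Omega> x)) \<le> (\<Sum>j. ennreal (cmod (\<mu> j) * cmod (a j x)))"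
    and sm: "summable (\<lambda>j. cmod (\<mu> j) * (1 + log_plus (1 / measure M (B j)) powr \<beta>))"
  shows "(\<integral>\<^sup>+ x. ennreal (cmod (\<Omega> x) * log_plus (cmod (\<Omega> x)) powr \<beta>) \<partial>M) < \<infinity>"
proof -
  obtain C where C: "C \<ge> 0" "\<And>m a u. m > 0 \<Longrightarrow> a \<ge> 0 \<Longrightarrow> u \<ge> 0 \<Longrightarrow> a * log_plus u powr \<beta> \<le>
      a * (2 * log_plus (1 / m)) powr \<beta> + (m * a) powr q / m + C * u"
    using mult_log_plus_powr_le[OF \<beta> q] by blast
  define m where "m j = measure M (B j)" for j
  define g where "g x = log_plus (cmod (\<Omega> x)) powr \<beta>" for x
  define A where "A = enn2real (\<integral>\<^sup>+ x. ennreal (cmod (\<Omega> x)) \<partial>M)"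
  have \<Omega>m [measurable]: "\<Omega> \<in> borel_measurable M" using int by auto
  have gm [measurable]: "g \<in> borel_measurable M" unfolding g_def by measurable
  have am [measurable]: "a j \<in> borel_measurable M" for j using b by (auto simp: normalized_block_def)
  have g0: "0 \<le> g x" for x by (simp add: g_def)
  have mpos: "m j > 0" for j using b by (auto simp: normalized_block_def m_def)
  have A: "(\<integral>\<^sup>+ x. ennreal (cmod (\<Omega> x)) \<partial>M) = ennreal A" "A \<ge> 0"
    using int by (auto simp: A_def integrable_iff_bounded less_top)
  define K where "K j = (2 * log_plus (1 / m j)) powr \<beta>" for j
  have K0: "K j \<ge> 0" for j by (simp add: K_def)
  \<comment> \<open>The summands come from the mass bound 2 of a block together with the factor
    2^\<beta> in \<open>K j\<close>, from the power integral divided by \<open>m j\<close>, and from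
    \<open>\<Omega>\<close>.\<close>
  define R where "R = 2 * 2 powr \<beta> + 1 + C * A"
  have R0: "R \<ge> 0" using C A by (simp add: R_def)
  have one: "(\<integral>\<^sup>+ x. ennreal (cmod (a j x) * g x) \<partial>M) \<le> ennreal (R * (1 + log_plus (1 / m j) powr \<beta>))" for j
  proof -
    have "(\<integral>\<^sup>+ x. ennreal (cmod (a j x) * g x) \<partial>M) \<le>
        (\<integral>\<^sup>+ x. ennreal (K j) * ennreal (cmod (a j x)) +
          (ennreal (1 / m j) * ennreal ((m j * cmod (a j x)) powr q) + ennreal C * ennreal (cmod (\<Omega> x))) \<partial>M)"
    proof (rule nn_integral_mono)
      fix x
      have "cmod (a j x) * g x \<le> K j * cmod (a j x) + (1 / m j * (m j * cmod (a j x)) powr q + C * cmod (\<Omega> x))"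
        using C(2)[of "m j" "cmod (a j x)" "cmod (\<Omega> x)"] mpos[of j] by (simp add: K_def g_def mult_ac)
      then show "ennreal (cmod (a j x) * g x) \<le> ennreal (K j) * ennreal (cmod (a j x)) +
          (ennreal (1 / m j) * ennreal ((m j * cmod (a j x)) powr q) + ennreal C * ennreal (cmod (\<Omega> x)))"
        using C(1) mpos[of j] K0 by (simp flip: ennreal_mult ennreal_plus)
    qed
    also have "\<dots> = ennreal (K j) * (\<integral>\<^sup>+ x. ennreal (cmod (a j x)) \<partial>M) +
        (ennreal (1 / m j) * (\<integral>\<^sup>+ x. ennreal ((m j * cmod (a j x)) powr q) \<partial>M) + ennreal C * ennreal A)"
      by (simp add: nn_integral_add nn_integral_cmult A)
    also have "\<dots> \<le> ennreal (K j) * 2 + (ennreal (1 / m j) * ennreal (m j) + ennreal C * ennreal A)"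
      using b[of j] nn_integral_normalized_block[OF b q, of j]
      by (intro add_mono mult_left_mono order_refl) (auto simp: normalized_block_def m_def)
    also have "\<dots> = ennreal (K j * 2 + (1 + C * A))"
      using mpos[of j] K0 C(1) A(2) by (simp flip: ennreal_mult ennreal_plus ennreal_numeral ennreal_1)
    also have "\<dots> \<le> ennreal (R * (1 + log_plus (1 / m j) powr \<beta>))"
    proof (rule ennreal_leI)
      define L where "L = log_plus (1 / m j) powr \<beta>"
      have L: "L \<ge> 0" by (simp add: L_def)
      have "K j = 2 powr \<beta> * L" by (simp add: K_def L_def powr_mult)
      moreover have "0 \<le> 2 * 2 powr \<beta> + (1 + C * A) * L" using L C A by (intro add_nonneg_nonneg mult_nonneg_nonneg) auto
      ultimately show "K j * 2 + (1 + C * A) \<le> R * (1 + log_plus (1 / m j) powr \<beta>)"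
        unfolding R_def L_def[symmetric] by (simp add: algebra_simps)
    qed
    finally show ?thesis .
  qed
  have "(\<integral>\<^sup>+ x. ennreal (cmod (\<Omega> x) * g x) \<partial>M) \<le> (\<integral>\<^sup>+ x. (\<Sum>j. ennreal (cmod (\<mu> j)) * ennreal (cmod (a j x) * g x)) \<partial>M)"
  proof (rule nn_integral_mono_AE)
    show "AE x in M. ennreal (cmod (\<Omega> x) * g x) \<le> (\<Sum>j. ennreal (cmod (\<mu> j)) * ennreal (cmod (a j x) * g x))"
      using dom
    proof eventually_elim
      case (elim x)
      have "ennreal (cmod (\<Omega> x) * g x) = ennreal (cmod (\<Omega> x)) * ennreal (g x)"
        using g0 by (simp add: ennreal_mult)
      also have "\<dots> \<le> (\<Sum>j. ennreal (cmod (\<mu> j) * cmod (a j x))) * ennreal (g x)"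
        using elim by (intro mult_right_mono) auto
      also have "\<dots> = (\<Sum>j. ennreal (cmod (\<mu> j)) * ennreal (cmod (a j x) * g x))"
        using g0 by (simp add: ennreal_mult mult_ac flip: ennreal_suminf_multc)
      finally show ?case .
    qed
  qed
  also have "\<dots> = (\<Sum>j. ennreal (cmod (\<mu> j)) * (\<integral>\<^sup>+ x. ennreal (cmod (a j x) * g x) \<partial>M))"
    by (simp add: nn_integral_suminf nn_integral_cmult)
  also have "\<dots> \<le> (\<Sum>j. ennreal (R * (cmod (\<mu> j) * (1 + log_plus (1 / m j) powr \<beta>))))"
  proof (rule suminf_le)
    fix j
    have "ennreal (cmod (\<mu> j)) * (\<integral>\<^sup>+ x. ennreal (cmod (a j x) * g x) \<partial>M) \<le>
        ennreal (cmod (\<mu> j)) * ennreal (R * (1 + log_plus (1 / m j) powr \<beta>))"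
      using one by (intro mult_left_mono) auto
    also have "\<dots> = ennreal (R * (cmod (\<mu> j) * (1 + log_plus (1 / m j) powr \<beta>)))"
      using R0 by (simp add: mult_ac flip: ennreal_mult)
    finally show "ennreal (cmod (\<mu> j)) * (\<integral>\<^sup>+ x. ennreal (cmod (a j x) * g x) \<partial>M) \<le>
        ennreal (R * (cmod (\<mu> j) * (1 + log_plus (1 / m j) powr \<beta>)))" .
  qed auto
  also have "\<dots> < \<infinity>"
    using R0 summable_mult[OF sm, of R] unfolding m_def
    by (subst suminf_ennreal2) (auto intro!: mult_nonneg_nonneg)
  finally show ?thesis by (simp add: g_def)
qed

section \<open>Block spaces\<close>

lemma Lq_norm_1: "Lq_norm M 1 f = (\<integral>\<^sup>+ x. ennreal (cmod (f x)) \<partial>M)"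
  by (auto simp: Lq_norm_def Let_def less_top)

lemma powr_powr_inverse_le_iff:
  fixes I m r :: real
  assumes "I \<ge> 0" "m > 0" "r > 0"
  shows "I powr (1 / r) \<le> m powr (- s / r) \<longleftrightarrow> I \<le> m powr (- s)"
proof -
  have "I powr (1 / r) \<le> m powr (- s / r) \<longleftrightarrow> I powr (1 / r) \<le> (m powr (- s)) powr (1 / r)"
    by (simp add: powr_powr)
  also have "\<dots> \<longleftrightarrow> I \<le> m powr (- s)"
    using assms powr_less_mono2[of "1 / r" "m powr (- s)" I] powr_mono2[of "1 / r" I "m powr (- s)"]
    by (meson less_eq_real_def not_less powr_ge_zero zero_less_divide_1_iff)
  finally show ?thesis .
qed

text \<open>Raise the norm bound m^(-(p-1)/p) to the power p and multiply by m^p: the right-hand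
  side becomes m. Positivity of the cap measure makes this reversible.\<close>

lemma is_block_iff_normalized_block:
  fixes B :: "(real ^ 'n) set"
  assumes "p > 1"
  shows "is_block (ennreal p) B a \<longleftrightarrow> is_cap B \<and> normalized_block sphere_measure p B a"
proof (cases "is_cap B \<and> a \<in> borel_measurable sphere_measure")
  case True
  then have cap: "is_cap B" and [measurable]: "a \<in> borel_measurable sphere_measure" by auto
  define m where "m = measure sphere_measure B"
  have m: "m > 0" using sphere_measure_cap_pos[OF cap] by (simp add: m_def)
  define I where "I = (\<integral>\<^sup>+ x. ennreal (cmod (a x) powr p) \<partial>sphere_measure)"
  have ce: "- 1 / conjugate_exponent (ennreal p) = - (p - 1) / p"
    using assms by (simp add: conjugate_exponent_def)
  have n: "Lq_norm sphere_measure (ennreal p) a =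
      (if I = \<infinity> then \<infinity> else ennreal (enn2real I powr (1 / p)))"
    using assms by (simp add: Lq_norm_def I_def Let_def)
  have "(\<integral>\<^sup>+ x. ennreal ((m * cmod (a x)) powr p) \<partial>sphere_measure) =
      (\<integral>\<^sup>+ x. ennreal (m powr p) * ennreal (cmod (a x) powr p) \<partial>sphere_measure)"
    using m by (simp add: powr_mult ennreal_mult)
  also have "\<dots> = ennreal (m powr p) * I"
    by (simp add: nn_integral_cmult I_def)
  finally have J: "(\<integral>\<^sup>+ x. ennreal ((m * cmod (a x)) powr p) \<partial>sphere_measure) = ennreal (m powr p) * I" .
  have "Lq_norm sphere_measure (ennreal p) a \<le> ennreal (m powr (- 1 / conjugate_exponent (ennreal p))) \<longleftrightarrow>
      ennreal (m powr p) * I \<le> ennreal m"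
  proof (cases "I = \<infinity>")
    case True
    then show ?thesis using m by (simp add: n ennreal_mult_top top_unique)
  next
    case False
    then obtain i where i: "I = ennreal i" "i \<ge> 0" by (cases I) auto
    have "Lq_norm sphere_measure (ennreal p) a \<le> ennreal (m powr (- 1 / conjugate_exponent (ennreal p))) \<longleftrightarrow>
        i powr (1 / p) \<le> m powr (- (p - 1) / p)"
      unfolding n ce using i by simp
    also have "\<dots> \<longleftrightarrow> i \<le> m powr (- (p - 1))"
      using assms i m by (intro powr_powr_inverse_le_iff) auto
    also have "\<dots> \<longleftrightarrow> m powr p * i \<le> m powr p * m powr (- (p - 1))"
      using m by (subst mult_le_cancel_left_pos) auto
    also have "m powr p * m powr (- (p - 1)) = m" using m by (simp flip: powr_add)
    also have "m powr p * i \<le> m \<longleftrightarrow> ennreal (m powr p) * I \<le> ennreal m"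
      using i m by (simp flip: ennreal_mult)
    finally show ?thesis .
  qed
  then show ?thesis
    using cap m is_cap_in_sets[OF cap] J
    by (auto simp: is_block_def normalized_block_def m_def)
qed (auto simp: is_block_def normalized_block_def)

text \<open>On the support, y = m |a| satisfies y^p <= 1 + y^r, which integrates to at most 2 m;
  halving the block gains 2^(-p) <= 1/2. The factor, later moved into the coefficients, replaces an
  appeal to Hoelder's inequality.\<close>

lemma (in finite_measure) normalized_block_half_mono:
  assumes b: "normalized_block M r B a" and p: "1 < p" "p \<le> r"
  shows "normalized_block M p B (\<lambda>x. a x / 2)"
proof -
  define m where "m = measure M B"
  have B: "B \<in> sets M" "m > 0" "AE x in M. x \<notin> B \<longrightarrow> a x = 0"
      "(\<integral>\<^sup>+ x. ennreal ((m * cmod (a x)) powr r) \<partial>M) \<le> ennreal m"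
    and [measurable]: "a \<in> borel_measurable M"
    using b by (auto simp: normalized_block_def m_def)
  have "(\<integral>\<^sup>+ x. ennreal ((m * cmod (a x / 2)) powr p) \<partial>M) \<le>
      (\<integral>\<^sup>+ x. ennreal (1 / 2) * indicator B x + ennreal (1 / 2) * ennreal ((m * cmod (a x)) powr r) \<partial>M)"
  proof (rule nn_integral_mono_AE)
    show "AE x in M. ennreal ((m * cmod (a x / 2)) powr p) \<le>
        ennreal (1 / 2) * indicator B x + ennreal (1 / 2) * ennreal ((m * cmod (a x)) powr r)"
      using B(3)
    proof eventually_elim
      case (elim x)
      show ?case
      proof (cases "x \<in> B")
        case True
        define y where "y = m * cmod (a x)"
        have y: "y \<ge> 0" using B(2) by (simp add: y_def)
        have "2 powr 1 \<le> (2::real) powr p" using p by (intro powr_mono) auto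
        then have "y powr p / 2 powr p \<le> y powr p / 2" by (intro divide_left_mono) auto
        moreover have "y powr p \<le> 1 + y powr r"
        proof (cases "y \<le> 1")
          case True
          then have "y powr p \<le> 1" using y p by (intro powr_le1) auto
          then show ?thesis by (simp add: add_increasing2)
        next
          case False
          then have "y powr p \<le> y powr r" using p by (intro powr_mono) auto
          then show ?thesis by simp
        qed
        ultimately have "(y / 2) powr p \<le> 1 / 2 + 1 / 2 * y powr r"
          using y by (simp only: powr_divide)
        then have "ennreal ((y / 2) powr p) \<le> ennreal (1 / 2 + 1 / 2 * y powr r)"
          by (rule ennreal_leI)
        also have "\<dots> = ennreal (1 / 2) + ennreal (1 / 2) * ennreal (y powr r)"
          using ennreal_plus[of "1 / 2" "1 / 2 * y powr r"] ennreal_mult[of "1 / 2" "y powr r"] by simp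
        finally show ?thesis using True by (simp add: y_def norm_divide)
      qed (use elim in auto)
    qed
  qed
  also have "\<dots> = ennreal (1 / 2) * ennreal m + ennreal (1 / 2) * (\<integral>\<^sup>+ x. ennreal ((m * cmod (a x)) powr r) \<partial>M)"
    using B(1) by (simp add: nn_integral_add nn_integral_cmult emeasure_eq_measure m_def)
  also have "\<dots> \<le> ennreal (1 / 2) * ennreal m + ennreal (1 / 2) * ennreal m"
    using B(4) by (intro add_left_mono mult_left_mono) auto
  also have "\<dots> = ennreal m"
    using B(2) ennreal_mult[of "1 / 2" m] ennreal_plus[of "1 / 2 * m" "1 / 2 * m"] by simp
  finally show ?thesis using B by (auto simp: normalized_block_def m_def)
qed

text \<open>Almost everywhere m |a| <= 1, so its powers are bounded by the indicator of the
  support.\<close>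

lemma is_block_infinity_imp_normalized_block:
  fixes B :: "(real ^ 'n) set"
  assumes b: "is_block \<infinity> B a" and p: "p > 1"
  shows "normalized_block sphere_measure p B a"
proof -
  define m where "m = measure sphere_measure B"
  have B: "is_cap B" "AE x in sphere_measure. x \<notin> B \<longrightarrow> a x = 0"
      "esssup sphere_measure (\<lambda>x. ennreal (cmod (a x))) \<le> ennreal (m powr - 1)"
    and a [measurable]: "a \<in> borel_measurable sphere_measure"
    using b by (auto simp: is_block_def m_def Lq_norm_def conjugate_exponent_def)
  have m: "m > 0" using sphere_measure_cap_pos[OF B(1)] by (simp add: m_def)
  have Bs: "B \<in> sets sphere_measure" using B(1) by (rule is_cap_in_sets)
  have "AE x in sphere_measure. ennreal (cmod (a x)) \<le> ennreal (m powr - 1)"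
    using esssup_AE[where M = sphere_measure and f = "\<lambda>x. ennreal (cmod (a x))"]
  proof eventually_elim
    case (elim x)
    then show ?case using B(3) by (rule order_trans)
  qed
  with B(2) have "AE x in sphere_measure. ennreal ((m * cmod (a x)) powr p) \<le> indicator B x"
  proof eventually_elim
    case (elim x)
    show ?case
    proof (cases "x \<in> B")
      case True
      have "cmod (a x) \<le> 1 / m" using elim m by (simp add: powr_minus field_simps)
      then have "m * cmod (a x) \<le> 1" using m by (simp add: field_simps)
      then have "(m * cmod (a x)) powr p \<le> 1" using m p by (intro powr_le1) auto
      then show ?thesis using True by simp
    qed (use elim in auto)
  qed
  then have "(\<integral>\<^sup>+ x. ennreal ((m * cmod (a x)) powr p) \<partial>sphere_measure) \<le> (\<integral>\<^sup>+ x. indicator B x \<partial>sphere_measure)"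
    by (rule nn_integral_mono_AE)
  also have "\<dots> = ennreal m" using Bs by (simp add: sphere.emeasure_eq_measure m_def)
  finally show ?thesis using B Bs m a by (auto simp: normalized_block_def m_def)
qed

lemma normalized_block_half_if_is_block:
  fixes B :: "(real ^ 'n) set"
  assumes b: "is_block q B a" and p: "p > 1" "ennreal p \<le> q"
  shows "normalized_block sphere_measure p B (\<lambda>x. a x / 2)"
proof (cases "q = \<infinity>")
  case True
  then have "normalized_block sphere_measure p B a"
    using is_block_infinity_imp_normalized_block b p by blast
  then show ?thesis by (rule sphere.normalized_block_half_mono) (use p in auto)
next
  case False
  then obtain r where r: "q = ennreal r" "r \<ge> 0" by (cases q) auto
  then have "p \<le> r" using p by simp
  moreover have "normalized_block sphere_measure r B a"
    using b p \<open>p \<le> r\<close> unfolding r by (subst (asm) is_block_iff_normalized_block) auto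
  ultimately show ?thesis using p by (intro sphere.normalized_block_half_mono) auto
qed

section \<open>Series of blocks with a real exponent\<close>

text \<open>The witnesses are arguments, so that series can be interleaved, scaled and dominated
  term by term; \<open>\<beta>\<close> stands for 1 + \<nu>.\<close>

definition block_series ::
  "real \<Rightarrow> real \<Rightarrow> (real ^ 'n \<Rightarrow> complex) \<Rightarrow> (nat \<Rightarrow> complex) \<Rightarrow> (nat \<Rightarrow> real ^ 'n \<Rightarrow> complex) \<Rightarrow>
    (nat \<Rightarrow> (real ^ 'n) set) \<Rightarrow> bool" where
  "block_series p \<beta> \<Omega> \<mu> a B \<longleftrightarrow>
     integrable sphere_measure \<Omega> \<and>
     (\<forall>j. is_cap (B j) \<and> normalized_block sphere_measure p (B j) (a j)) \<and>
     (\<lambda>N. \<integral>\<^sup>+ x. ennreal (cmod (\<Omega> x - (\<Sum>j<N. \<mu> j * a j x))) \<partial>sphere_measure) \<longlonglongrightarrow> 0 \<and>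
     summable (\<lambda>j. cmod (\<mu> j) * (1 + log_plus (1 / measure sphere_measure (B j)) powr \<beta>))"

lemma block_space_if_block_series:
  assumes "block_series p (1 + \<nu>) \<Omega> \<mu> a B" "p > 1"
  shows "\<Omega> \<in> block_space (ennreal p) \<nu>"
  using assms
  by (auto simp: block_series_def block_space_def is_block_iff_normalized_block Lq_norm_1
      intro!: exI[of _ \<mu>] exI[of _ a] exI[of _ B])

lemma block_series_if_block_space:
  assumes "\<Omega> \<in> block_space q \<nu>" and p: "p > 1" "ennreal p \<le> q"
  shows "\<exists>\<mu> a B. block_series p (1 + \<nu>) \<Omega> \<mu> a B"
proof -
  obtain \<mu> a B where *: "integrable sphere_measure \<Omega>" "\<And>j. is_block q (B j) (a j)"
    "(\<lambda>N. Lq_norm sphere_measure 1 (\<lambda>x. \<Omega> x - (\<Sum>j<N. \<mu> j * a j x))) \<longlonglongrightarrow> 0"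
    "summable (\<lambda>j. cmod (\<mu> j) * (1 + log_plus (1 / measure sphere_measure (B j)) powr (1 + \<nu>)))"
    using assms(1) unfolding block_space_def by blast
  \<comment> \<open>Doubled coefficients compensate the halved blocks, so all partial sums are
    unchanged.\<close>
  have "block_series p (1 + \<nu>) \<Omega> (\<lambda>j. 2 * \<mu> j) (\<lambda>j x. a j x / 2) B"
    unfolding block_series_def
  proof (intro conjI allI)
    show "is_cap (B j)" for j using *(2)[of j] by (simp add: is_block_def)
    show "summable (\<lambda>j. cmod (2 * \<mu> j) * (1 + log_plus (1 / measure sphere_measure (B j)) powr (1 + \<nu>)))"
      using summable_mult[OF *(4), of 2] by (simp add: norm_mult mult.assoc)
    show "normalized_block sphere_measure p (B j) (\<lambda>x. a j x / 2)" for j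
      using normalized_block_half_if_is_block[OF *(2) p] .
  qed (use * in \<open>auto simp: Lq_norm_1\<close>)
  then show ?thesis by blast
qed

text \<open>Exponents can be lowered to any real p with 1 < p <= q, so q = infinity is absorbed by a
  real exponent.\<close>

lemma block_union_iff:
  "\<Omega> \<in> (\<Union>q\<in>{1<..\<infinity>}. block_space q \<nu>) \<longleftrightarrow>
    (\<exists>p>1. \<exists>\<mu> a B. block_series p (1 + \<nu>) \<Omega> \<mu> a B)"
proof
  assume "\<Omega> \<in> (\<Union>q\<in>{1<..\<infinity>}. block_space q \<nu>)"
  then obtain q where q: "1 < q" "\<Omega> \<in> block_space q \<nu>" by auto
  have "\<exists>p>1. ennreal p \<le> q"
  proof (cases q)
    case (real r)
    then have "1 < r" using q(1) by (metis ennreal_1 ennreal_less_iff zero_le_one)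
    then show ?thesis using real by (intro exI[of _ r]) auto
  next
    case top
    then show ?thesis by (intro exI[of _ 2]) auto
  qed
  then show "\<exists>p>1. \<exists>\<mu> a B. block_series p (1 + \<nu>) \<Omega> \<mu> a B"
    using block_series_if_block_space[OF q(2)] by blast
next
  assume "\<exists>p>1. \<exists>\<mu> a B. block_series p (1 + \<nu>) \<Omega> \<mu> a B"
  then obtain p where p: "p > 1" "\<Omega> \<in> block_space (ennreal p) \<nu>"
    using block_space_if_block_series by blast
  moreover have "1 < ennreal p" using p(1) by (metis ennreal_1 ennreal_less_iff zero_le_one)
  ultimately show "\<Omega> \<in> (\<Union>q\<in>{1<..\<infinity>}. block_space q \<nu>)" by auto
qed

lemma block_series_mono:
  assumes "block_series r \<beta> \<Omega> \<mu> a B" "1 < p" "p \<le> r"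
  shows "\<exists>\<mu> a B. block_series p \<beta> \<Omega> \<mu> a B"
  \<comment> \<open>The passage through \<open>block_space\<close> is taken at \<nu> = \<beta> - 1,
    so that the weight exponent is again \<beta>.\<close>
  using block_series_if_block_space[OF block_space_if_block_series[of r "\<beta> - 1" \<Omega> \<mu> a B], of p] assms
  by (auto intro: ennreal_leI)

text \<open>Among the first \<open>N\<close> indices, the even ones number N/2 rounded up, which is
  \<open>Suc N div 2\<close>, and the odd ones N/2 rounded down.\<close>

lemma sum_interleave:
  fixes f g :: "nat \<Rightarrow> 'a :: comm_monoid_add"
  shows "(\<Sum>j<N. if even j then f (j div 2) else g (j div 2)) =
    (\<Sum>j<Suc N div 2. f j) + (\<Sum>j<N div 2. g j)"
proof (induction N)
  case (Suc N)
  show ?case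
  proof (cases "even N")
    case True
    then have "Suc N div 2 = N div 2" "Suc (Suc N) div 2 = Suc (N div 2)" by presburger+
    then show ?thesis using Suc True by (simp add: add_ac)
  next
    case False
    then have "Suc N div 2 = Suc (N div 2)" "Suc (Suc N) div 2 = Suc (N div 2)" by presburger+
    then show ?thesis using Suc False by (simp add: add_ac)
  qed
qed simp

text \<open>In the interleaved series, each partial sum splits into partial sums of both series
  whose lengths tend to infinity, so L^1 convergence follows from the triangle inequality.\<close>

lemma block_series_add:
  assumes f: "block_series p \<beta> f \<mu>1 a1 B1" and g: "block_series p \<beta> g \<mu>2 a2 B2"
  shows "\<exists>\<mu> a B. block_series p \<beta> (\<lambda>x. f x + g x) \<mu> a B"
proof -
  define \<mu> where "\<mu> j = (if even j then \<mu>1 (j div 2) else \<mu>2 (j div 2))" for j :: nat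
  define a where "a j = (if even j then a1 (j div 2) else a2 (j div 2))" for j :: nat
  define B where "B j = (if even j then B1 (j div 2) else B2 (j div 2))" for j :: nat
  let ?w = "\<lambda>\<mu> B j. cmod (\<mu> j) * (1 + log_plus (1 / measure sphere_measure (B j)) powr \<beta>)"
  have [measurable]: "f \<in> borel_measurable sphere_measure" "g \<in> borel_measurable sphere_measure"
    "\<And>j. a1 j \<in> borel_measurable sphere_measure" "\<And>j. a2 j \<in> borel_measurable sphere_measure"
    using f g by (auto simp: block_series_def normalized_block_def)
  \<comment> \<open>\<open>sums_if\<close> indexes odd positions by (j - 1) div 2, which agrees with
    j div 2 there.\<close>
  have div2: "(j - Suc 0) div 2 = j div 2" if "odd j" for j :: nat using that by presburger
  have weq: "?w \<mu> B = (\<lambda>j. if even j then ?w \<mu>1 B1 (j div 2) else ?w \<mu>2 B2 ((j - 1) div 2))"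
    by (auto simp: \<mu>_def B_def fun_eq_iff div2)
  have w12: "?w \<mu>1 B1 sums suminf (?w \<mu>1 B1)" "?w \<mu>2 B2 sums suminf (?w \<mu>2 B2)"
    using f g unfolding block_series_def by (blast intro: summable_sums)+
  have "?w \<mu> B sums (suminf (?w \<mu>2 B2) + suminf (?w \<mu>1 B1))"
    unfolding weq by (rule sums_if[OF w12(2) w12(1)])
  then have sm: "summable (?w \<mu> B)" by (rule sums_summable)
  let ?F = "\<lambda>N. \<integral>\<^sup>+ x. ennreal (cmod (f x - (\<Sum>j<N. \<mu>1 j * a1 j x))) \<partial>sphere_measure"
  let ?G = "\<lambda>N. \<integral>\<^sup>+ x. ennreal (cmod (g x - (\<Sum>j<N. \<mu>2 j * a2 j x))) \<partial>sphere_measure"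
  let ?H = "\<lambda>N. \<integral>\<^sup>+ x. ennreal (cmod (f x + g x - (\<Sum>j<N. \<mu> j * a j x))) \<partial>sphere_measure"
  have le: "?H N \<le> ?F (Suc N div 2) + ?G (N div 2)" for N
  proof -
    have "?H N \<le> (\<integral>\<^sup>+ x. ennreal (cmod (f x - (\<Sum>j<Suc N div 2. \<mu>1 j * a1 j x))) +
        ennreal (cmod (g x - (\<Sum>j<N div 2. \<mu>2 j * a2 j x))) \<partial>sphere_measure)"
    proof (rule nn_integral_mono)
      fix x
      have "(\<Sum>j<N. \<mu> j * a j x) =
          (\<Sum>j<N. if even j then \<mu>1 (j div 2) * a1 (j div 2) x else \<mu>2 (j div 2) * a2 (j div 2) x)"
        by (intro sum.cong) (auto simp: \<mu>_def a_def)
      also have "\<dots> = (\<Sum>j<Suc N div 2. \<mu>1 j * a1 j x) + (\<Sum>j<N div 2. \<mu>2 j * a2 j x)"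
        by (rule sum_interleave)
      finally have eq: "f x + g x - (\<Sum>j<N. \<mu> j * a j x) =
          (f x - (\<Sum>j<Suc N div 2. \<mu>1 j * a1 j x)) + (g x - (\<Sum>j<N div 2. \<mu>2 j * a2 j x))"
        by simp
      show "ennreal (cmod (f x + g x - (\<Sum>j<N. \<mu> j * a j x))) \<le>
          ennreal (cmod (f x - (\<Sum>j<Suc N div 2. \<mu>1 j * a1 j x))) +
          ennreal (cmod (g x - (\<Sum>j<N div 2. \<mu>2 j * a2 j x)))"
        unfolding eq ennreal_plus[OF norm_ge_zero norm_ge_zero, symmetric]
        by (intro ennreal_leI norm_triangle_ineq)
    qed
    also have "\<dots> = ?F (Suc N div 2) + ?G (N div 2)" by (intro nn_integral_add) measurable
    finally show ?thesis .
  qed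
  have lim: "filterlim (\<lambda>N::nat. Suc N div 2) at_top sequentially"
    "filterlim (\<lambda>N::nat. N div 2) at_top sequentially"
    unfolding filterlim_at_top eventually_sequentially by presburger+
  have FG: "?F \<longlonglongrightarrow> 0" "?G \<longlonglongrightarrow> 0" using f g unfolding block_series_def by blast+
  have "(\<lambda>N. ?F (Suc N div 2) + ?G (N div 2)) \<longlonglongrightarrow> 0 + 0"
    by (intro tendsto_add filterlim_compose[OF FG(1) lim(1)] filterlim_compose[OF FG(2) lim(2)])
  then have "(\<lambda>N. ?F (Suc N div 2) + ?G (N div 2)) \<longlonglongrightarrow> 0" by simp
  from tendsto_sandwich[OF _ _ tendsto_const this, of ?H] le have lim0: "?H \<longlonglongrightarrow> 0" by simp
  have "integrable sphere_measure (\<lambda>x. f x + g x)"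
    using f g by (simp add: block_series_def)
  moreover have "is_cap (B j) \<and> normalized_block sphere_measure p (B j) (a j)" for j
    using f g by (simp add: block_series_def a_def B_def)
  ultimately have "block_series p \<beta> (\<lambda>x. f x + g x) \<mu> a B"
    unfolding block_series_def using sm lim0 by blast
  then show ?thesis by blast
qed

lemma block_series_cmult:
  assumes f: "block_series p \<beta> f \<mu> a B"
  shows "block_series p \<beta> (\<lambda>x. c * f x) (\<lambda>j. c * \<mu> j) a B"
proof -
  have [measurable]: "f \<in> borel_measurable sphere_measure" "\<And>j. a j \<in> borel_measurable sphere_measure"
    using f by (auto simp: block_series_def normalized_block_def)
  have "(\<integral>\<^sup>+ x. ennreal (cmod (c * f x - (\<Sum>j<N. c * \<mu> j * a j x))) \<partial>sphere_measure) =
      ennreal (cmod c) * (\<integral>\<^sup>+ x. ennreal (cmod (f x - (\<Sum>j<N. \<mu> j * a j x))) \<partial>sphere_measure)" for N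
  proof -
    have "c * f x - (\<Sum>j<N. c * \<mu> j * a j x) = c * (f x - (\<Sum>j<N. \<mu> j * a j x))" for x
      by (simp add: sum_distrib_left algebra_simps)
    then show ?thesis by (simp add: norm_mult ennreal_mult nn_integral_cmult)
  qed
  moreover have "(\<lambda>N. ennreal (cmod c) * (\<integral>\<^sup>+ x. ennreal (cmod (f x - (\<Sum>j<N. \<mu> j * a j x))) \<partial>sphere_measure))
      \<longlonglongrightarrow> ennreal (cmod c) * 0"
    using f by (intro ennreal_tendsto_cmult) (auto simp: block_series_def)
  moreover have "summable (\<lambda>j. cmod (c * \<mu> j) * (1 + log_plus (1 / measure sphere_measure (B j)) powr \<beta>))"
    using f summable_mult[of _ "cmod c"] by (simp add: block_series_def norm_mult mult.assoc)
  ultimately show ?thesis using f by (auto simp: block_series_def)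
qed

lemma block_series_zero:
  assumes "p > 1"
  shows "block_series p \<beta> (\<lambda>x :: real ^ 'n. 0) (\<lambda>j. 0) (\<lambda>j x. 0) (\<lambda>j. cap (axis undefined 1) 1)"
proof -
  have "is_cap (cap (axis undefined 1 :: real ^ 'n) 1)" by (auto simp: is_cap_def intro!: bexI exI)
  then show ?thesis using assms
    by (auto simp: block_series_def normalized_block_def cap_in_sets sphere_measure_cap_pos)
qed

text \<open>A union of subspaces need not be one; here the spaces are nested, and two summands are
  first brought to the smaller of their exponents.\<close>

lemma function_subspace_block_union:
  "function_subspace (\<Union>q\<in>{1<..\<infinity>}. block_space q \<nu> :: (real ^ 'n \<Rightarrow> complex) set)"
  unfolding function_subspace_iff block_union_iff
proof (intro conjI ballI allI)
  show "\<exists>p>1. \<exists>\<mu> a B. block_series p (1 + \<nu>) (\<lambda>x. 0) \<mu> a B"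
    using block_series_zero[of 2] by (intro exI[of _ 2]) auto
next
  fix f g :: "real ^ 'n \<Rightarrow> complex"
  assume "f \<in> (\<Union>q\<in>{1<..\<infinity>}. block_space q \<nu>)" "g \<in> (\<Union>q\<in>{1<..\<infinity>}. block_space q \<nu>)"
  then obtain p1 \<mu>1 a1 B1 p2 \<mu>2 a2 B2 where
    p: "1 < p1" "1 < p2" and f: "block_series p1 (1 + \<nu>) f \<mu>1 a1 B1"
    and g: "block_series p2 (1 + \<nu>) g \<mu>2 a2 B2" unfolding block_union_iff by blast
  have "\<exists>\<mu> a B. block_series (min p1 p2) (1 + \<nu>) f \<mu> a B"
    "\<exists>\<mu> a B. block_series (min p1 p2) (1 + \<nu>) g \<mu> a B"
    using block_series_mono[OF f] block_series_mono[OF g] p by auto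
  then have "\<exists>\<mu> a B. block_series (min p1 p2) (1 + \<nu>) (\<lambda>x. f x + g x) \<mu> a B"
    by (elim exE) (rule block_series_add)
  then show "\<exists>p>1. \<exists>\<mu> a B. block_series p (1 + \<nu>) (\<lambda>x. f x + g x) \<mu> a B"
    using p by (intro exI[of _ "min p1 p2"]) auto
next
  fix c and f :: "real ^ 'n \<Rightarrow> complex"
  assume "f \<in> (\<Union>q\<in>{1<..\<infinity>}. block_space q \<nu>)"
  then obtain p \<mu> a B where p: "p > 1" and f: "block_series p (1 + \<nu>) f \<mu> a B"
    unfolding block_union_iff by blast
  show "\<exists>p>1. \<exists>\<mu> a B. block_series p (1 + \<nu>) (\<lambda>x. c * f x) \<mu> a B"
    using p block_series_cmult[OF f] by (intro exI conjI)
qed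

text \<open>The truncated difference of |\<Omega>| and the series of moduli is at most |\<Omega> -
  S_N| for every partial sum S_N, hence has integral 0. This extracts pointwise information from L^1
  convergence without passing to a subsequence.\<close>

lemma block_series_dominated:
  assumes "block_series p \<beta> \<Omega> \<mu> a B"
  shows "AE x in sphere_measure. ennreal (cmod (\<Omega> x)) \<le> (\<Sum>j. ennreal (cmod (\<mu> j) * cmod (a j x)))"
proof -
  have [measurable]: "\<Omega> \<in> borel_measurable sphere_measure" "\<And>j. a j \<in> borel_measurable sphere_measure"
    using assms unfolding block_series_def normalized_block_def by (simp_all add: borel_measurable_integrable)
  let ?F = "\<lambda>x. \<Sum>j. ennreal (cmod (\<mu> j) * cmod (a j x))"
  let ?I = "\<lambda>N. \<integral>\<^sup>+ x. ennreal (cmod (\<Omega> x - (\<Sum>j<N. \<mu> j * a j x))) \<partial>sphere_measure"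
  \<comment> \<open>Subtraction in \<open>ennreal\<close> truncates at 0; it also gives 0 where the
    series is infinite, as the minuend is finite.\<close>
  have "(\<integral>\<^sup>+ x. ennreal (cmod (\<Omega> x)) - ?F x \<partial>sphere_measure) \<le> ?I N" for N
  proof (rule nn_integral_mono)
    fix x
    have "cmod (\<Omega> x) \<le> cmod (\<Omega> x - (\<Sum>j<N. \<mu> j * a j x)) + (\<Sum>j<N. cmod (\<mu> j) * cmod (a j x))"
      using norm_triangle_sub[of "\<Omega> x" "\<Sum>j<N. \<mu> j * a j x"] norm_sum[of "\<lambda>j. \<mu> j * a j x" "{..<N}"]
      by (simp add: norm_mult)
    then have 1: "ennreal (cmod (\<Omega> x)) \<le> ennreal (cmod (\<Omega> x - (\<Sum>j<N. \<mu> j * a j x))) +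
        ennreal (\<Sum>j<N. cmod (\<mu> j) * cmod (a j x))"
      by (simp add: sum_nonneg flip: ennreal_plus)
    have "ennreal (\<Sum>j<N. cmod (\<mu> j) * cmod (a j x)) = (\<Sum>j<N. ennreal (cmod (\<mu> j) * cmod (a j x)))"
      by (rule sum_ennreal[symmetric]) simp
    also have "\<dots> \<le> ?F x" by (rule sum_le_suminf) auto
    finally have "ennreal (cmod (\<Omega> x)) \<le> ?F x + ennreal (cmod (\<Omega> x - (\<Sum>j<N. \<mu> j * a j x)))"
      by (subst add.commute) (rule order_trans[OF 1 add_left_mono])
    then show "ennreal (cmod (\<Omega> x)) - ?F x \<le> ennreal (cmod (\<Omega> x - (\<Sum>j<N. \<mu> j * a j x)))"
      unfolding ennreal_minus_le_iff using ennreal_neq_top by blast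
  qed
  then have le: "\<exists>N0. \<forall>N\<ge>N0. (\<integral>\<^sup>+ x. ennreal (cmod (\<Omega> x)) - ?F x \<partial>sphere_measure) \<le> ?I N"
    by blast
  have "?I \<longlonglongrightarrow> 0" using assms unfolding block_series_def by blast
  from LIMSEQ_le_const[OF this le]
  have zero: "(\<integral>\<^sup>+ x. ennreal (cmod (\<Omega> x)) - ?F x \<partial>sphere_measure) = 0" by (simp only: le_zero_eq)
  have "(\<lambda>x. ennreal (cmod (\<Omega> x)) - ?F x) \<in> borel_measurable sphere_measure" by measurable
  from nn_integral_0_iff_AE[OF this] zero
  have "AE x in sphere_measure. ennreal (cmod (\<Omega> x)) - ?F x = 0" by blast
  then show ?thesis
  proof eventually_elim
    case (elim x)
    then show ?case unfolding diff_eq_0_iff_ennreal by blast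
  qed
qed

lemma block_union_subset_L_log_L:
  assumes "\<nu> > - 1"
  shows "(\<Union>q\<in>{1<..\<infinity>}. block_space q \<nu>) \<subseteq> L_log_L (1 + \<nu>)"
proof
  fix \<Omega> assume "\<Omega> \<in> (\<Union>q\<in>{1<..\<infinity>}. block_space q \<nu>)"
  then obtain p \<mu> a B where p: "1 < p" and s: "block_series p (1 + \<nu>) \<Omega> \<mu> a B"
    unfolding block_union_iff by blast
  have "(\<integral>\<^sup>+ x. ennreal (cmod (\<Omega> x) * log_plus (cmod (\<Omega> x)) powr (1 + \<nu>)) \<partial>sphere_measure) < \<infinity>"
    using s assms
    by (intro sphere.nn_integral_log_plus_powr_finite[OF _ p _ _ block_series_dominated[OF s], of "1 + \<nu>" B])
      (auto simp: block_series_def)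
  then show "\<Omega> \<in> L_log_L (1 + \<nu>)" using s by (auto simp: L_log_L_def block_series_def)
qed

section \<open>The space L log L\<close>

definition log_plus_weight :: "real \<Rightarrow> real \<Rightarrow> real" where
  "log_plus_weight \<beta> u = u * log_plus u powr \<beta>"

lemma log_plus_weight_nonneg: "0 \<le> u \<Longrightarrow> 0 \<le> log_plus_weight \<beta> u"
  by (simp add: log_plus_weight_def)

lemma log_plus_weight_measurable [measurable]: "log_plus_weight \<beta> \<in> borel_measurable borel"
  unfolding log_plus_weight_def by measurable

lemma log_plus_weight_mono:
  assumes "0 \<le> \<beta>" "0 \<le> s" "s \<le> t"
  shows "log_plus_weight \<beta> s \<le> log_plus_weight \<beta> t"
  unfolding log_plus_weight_def using assms by (intro mult_mono powr_mono2 log_plus_mono) auto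

text \<open>A doubling condition with a linear term: for u <= 1 the weight vanishes at u but
  possibly not at c u. The linear term is harmless for integrable functions.\<close>

lemma log_plus_weight_mult_le:
  assumes "0 \<le> \<beta>" "0 \<le> c"
  shows "\<exists>C\<ge>0. \<forall>u\<ge>0. log_plus_weight \<beta> (c * u) \<le> C * u + C * log_plus_weight \<beta> u"
proof (intro exI conjI allI impI)
  \<comment> \<open>The summand 1 lets one constant bound both coefficients, even if
    \<open>log_plus c\<close> is 0.\<close>
  let ?C = "c * 2 powr \<beta> * (log_plus c powr \<beta> + 1)"
  show "0 \<le> ?C" using assms by simp
  fix u :: real assume u: "0 \<le> u"
  have "log_plus (c * u) powr \<beta> \<le> (log_plus c + log_plus u) powr \<beta>"
    using assms u by (intro powr_mono2 log_plus_mult_le) auto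
  also have "\<dots> \<le> 2 powr \<beta> * (log_plus c powr \<beta> + log_plus u powr \<beta>)"
    using assms by (intro add_powr_le) auto
  also have "\<dots> \<le> 2 powr \<beta> * ((log_plus c powr \<beta> + 1) + (log_plus c powr \<beta> + 1) * log_plus u powr \<beta>)"
    by (intro mult_left_mono) (auto simp: algebra_simps)
  finally have "c * u * log_plus (c * u) powr \<beta> \<le>
      c * u * (2 powr \<beta> * ((log_plus c powr \<beta> + 1) + (log_plus c powr \<beta> + 1) * log_plus u powr \<beta>))"
    using assms u by (intro mult_left_mono) auto
  then show "log_plus_weight \<beta> (c * u) \<le> ?C * u + ?C * log_plus_weight \<beta> u"
    by (simp add: log_plus_weight_def algebra_simps)
qed

lemma L_log_L_iff:
  "f \<in> L_log_L \<beta> \<longleftrightarrow> integrable sphere_measure f \<and>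
    (\<integral>\<^sup>+ x. ennreal (log_plus_weight \<beta> (cmod (f x))) \<partial>sphere_measure) < \<infinity>"
  by (simp add: L_log_L_def log_plus_weight_def)

lemma nn_integral_log_plus_weight_scaled:
  assumes f: "f \<in> L_log_L \<beta>" and \<beta>: "0 \<le> \<beta>" and c: "0 \<le> c"
  shows "(\<integral>\<^sup>+ x. ennreal (log_plus_weight \<beta> (c * cmod (f x))) \<partial>sphere_measure) < \<infinity>"
proof -
  have int: "integrable sphere_measure f" using f by (simp add: L_log_L_iff)
  have [measurable]: "f \<in> borel_measurable sphere_measure" using int by simp
  obtain C where C: "C \<ge> 0" "\<And>u. u \<ge> 0 \<Longrightarrow> log_plus_weight \<beta> (c * u) \<le> C * u + C * log_plus_weight \<beta> u"
    using log_plus_weight_mult_le[OF \<beta> c] by blast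
  have "(\<integral>\<^sup>+ x. ennreal (log_plus_weight \<beta> (c * cmod (f x))) \<partial>sphere_measure) \<le>
      (\<integral>\<^sup>+ x. ennreal C * ennreal (cmod (f x)) + ennreal C * ennreal (log_plus_weight \<beta> (cmod (f x))) \<partial>sphere_measure)"
  proof (rule nn_integral_mono)
    fix x
    have "ennreal (log_plus_weight \<beta> (c * cmod (f x))) \<le>
        ennreal (C * cmod (f x) + C * log_plus_weight \<beta> (cmod (f x)))"
      using C(2) by (intro ennreal_leI) simp
    also have "\<dots> = ennreal C * ennreal (cmod (f x)) + ennreal C * ennreal (log_plus_weight \<beta> (cmod (f x)))"
      using C(1) by (simp add: ennreal_plus ennreal_mult log_plus_weight_nonneg)
    finally show "ennreal (log_plus_weight \<beta> (c * cmod (f x))) \<le>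
        ennreal C * ennreal (cmod (f x)) + ennreal C * ennreal (log_plus_weight \<beta> (cmod (f x)))" .
  qed
  also have "\<dots> = ennreal C * (\<integral>\<^sup>+ x. ennreal (cmod (f x)) \<partial>sphere_measure) +
      ennreal C * (\<integral>\<^sup>+ x. ennreal (log_plus_weight \<beta> (cmod (f x))) \<partial>sphere_measure)"
    by (simp add: nn_integral_add nn_integral_cmult)
  also have "\<dots> < \<infinity>"
    using f int by (simp add: L_log_L_iff integrable_iff_bounded ennreal_mult_less_top)
  finally show ?thesis .
qed

text \<open>For \<beta> < 1 the weight is not convex near 1, so sums are handled by |f + g| <= 2
  max(|f|, |g|), monotonicity and scaling.\<close>

lemma function_subspace_L_log_L:
  assumes \<beta>: "\<beta> > 0"
  shows "function_subspace (L_log_L \<beta> :: (real ^ 'n \<Rightarrow> complex) set)"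
  unfolding function_subspace_iff
proof (intro conjI ballI allI)
  show "(\<lambda>x. 0) \<in> (L_log_L \<beta> :: (real ^ 'n \<Rightarrow> complex) set)"
    by (simp add: L_log_L_iff log_plus_weight_def)
next
  fix f g :: "real ^ 'n \<Rightarrow> complex"
  assume f: "f \<in> L_log_L \<beta>" and g: "g \<in> L_log_L \<beta>"
  then have int: "integrable sphere_measure f" "integrable sphere_measure g"
    by (auto simp: L_log_L_iff)
  then have [measurable]: "f \<in> borel_measurable sphere_measure" "g \<in> borel_measurable sphere_measure"
    by auto
  have "(\<integral>\<^sup>+ x. ennreal (log_plus_weight \<beta> (cmod (f x + g x))) \<partial>sphere_measure) \<le>
      (\<integral>\<^sup>+ x. ennreal (log_plus_weight \<beta> (2 * cmod (f x))) + ennreal (log_plus_weight \<beta> (2 * cmod (g x))) \<partial>sphere_measure)"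
  proof (rule nn_integral_mono)
    fix x
    have "cmod (f x + g x) \<le> 2 * cmod (f x) \<or> cmod (f x + g x) \<le> 2 * cmod (g x)"
      using norm_triangle_ineq[of "f x" "g x"] by linarith
    then have "log_plus_weight \<beta> (cmod (f x + g x)) \<le> log_plus_weight \<beta> (2 * cmod (f x)) \<or>
        log_plus_weight \<beta> (cmod (f x + g x)) \<le> log_plus_weight \<beta> (2 * cmod (g x))"
      using \<beta> by (auto intro!: log_plus_weight_mono)
    then show "ennreal (log_plus_weight \<beta> (cmod (f x + g x))) \<le>
        ennreal (log_plus_weight \<beta> (2 * cmod (f x))) + ennreal (log_plus_weight \<beta> (2 * cmod (g x)))"
      by (auto intro: add_increasing add_increasing2 ennreal_leI)
  qed
  also have "\<dots> = (\<integral>\<^sup>+ x. ennreal (log_plus_weight \<beta> (2 * cmod (f x))) \<partial>sphere_measure) +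
      (\<integral>\<^sup>+ x. ennreal (log_plus_weight \<beta> (2 * cmod (g x))) \<partial>sphere_measure)"
    by (simp add: nn_integral_add)
  also have "\<dots> < \<infinity>"
    using nn_integral_log_plus_weight_scaled[OF f, of 2] nn_integral_log_plus_weight_scaled[OF g, of 2] \<beta>
    by simp
  finally show "(\<lambda>x. f x + g x) \<in> L_log_L \<beta>" using int by (simp add: L_log_L_iff)
next
  fix c and f :: "real ^ 'n \<Rightarrow> complex"
  assume f: "f \<in> L_log_L \<beta>"
  then have "integrable sphere_measure f" by (auto simp: L_log_L_iff)
  then show "(\<lambda>x. c * f x) \<in> L_log_L \<beta>"
    using nn_integral_log_plus_weight_scaled[OF f, of "cmod c"] \<beta>
    by (simp add: L_log_L_iff norm_mult)
qed

section \<open>Properness\<close>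

lemma exponential_times_polynomial_tendsto_0:
  fixes s b :: real
  assumes "s > 0" "b > 0"
  shows "(\<lambda>k. (2 powr - real k) powr s * (1 + real k) powr b) \<longlonglongrightarrow> 0"
proof -
  \<comment> \<open>Chosen so that the sequence is the b-th power of (k + 1) \<rho>^k, because
    \<rho>^b = 2^(-s).\<close>
  define \<rho> :: real where "\<rho> = 2 powr (- (s / b))"
  have \<rho>: "0 < \<rho>" "\<rho> < 1" using assms by (auto simp: \<rho>_def powr_less_one)
  have "(\<lambda>k. real k * \<rho> ^ k) \<longlonglongrightarrow> 0" using \<rho> by (intro powser_times_n_limit_0) auto
  moreover have "(\<lambda>k. \<rho> ^ k) \<longlonglongrightarrow> 0" using \<rho> by (intro LIMSEQ_power_zero) auto
  ultimately have "(\<lambda>k. real k * \<rho> ^ k + \<rho> ^ k) \<longlonglongrightarrow> 0 + 0" by (rule tendsto_add)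
  then have "(\<lambda>k. (real k * \<rho> ^ k + \<rho> ^ k) powr b) \<longlonglongrightarrow> 0 powr b"
    using \<rho> assms by (intro tendsto_powr') auto
  moreover have "(real k * \<rho> ^ k + \<rho> ^ k) powr b = (2 powr - real k) powr s * (1 + real k) powr b" for k
  proof -
    have "real k * \<rho> ^ k + \<rho> ^ k = \<rho> powr real k * (1 + real k)"
      using \<rho> by (simp add: powr_realpow algebra_simps)
    also have "\<rho> powr real k = (2 powr - real k) powr (s / b)"
      by (simp add: \<rho>_def powr_powr algebra_simps)
    finally show ?thesis using assms by (simp add: powr_mult powr_powr)
  qed
  ultimately show ?thesis using assms by simp
qed

text \<open>
  A block on a large cap sees only the fraction \<open>3 t\<close> of its cap in a spread set of density \<open>t\<close>, and
  gains a power of \<open>t\<close> from its exponent. A block on a small cap sees no such cancellation, but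
  its logarithmic weight makes it too expensive.
\<close>

lemma nn_integral_block_series_on_spread_set:
  fixes E :: "(real ^ 'n) set"
  assumes f: "block_series p \<beta> f \<mu> a B" and p: "p > 1" and \<beta>: "\<beta> > 0"
    and t: "0 < t" "t \<le> 1" and E: "E \<in> sets sphere_measure"
    and spread: "\<And>M. is_cap M \<Longrightarrow> measure sphere_measure M \<ge> exp (- ((1 / t) powr (1 / \<beta>))) \<Longrightarrow>
      measure sphere_measure (E \<inter> M) \<le> 3 * t * measure sphere_measure M"
  shows "(\<integral>\<^sup>+ x. ennreal (cmod (f x)) * indicator E x \<partial>sphere_measure) \<le>
    ennreal (6 * t powr (min (1 / 2) ((p - 1) / 2)) *
      (\<Sum>j. cmod (\<mu> j) * (1 + log_plus (1 / measure sphere_measure (B j)) powr \<beta>)))"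
proof -
  \<comment> \<open>At level t^(-1/2) the two terms of the block estimate are at most 3 t^(1/2) and
    t^((p-1)/2); \<open>s\<close> is the smaller exponent.\<close>
  define s where "s = min (1 / 2) ((p - 1) / 2)"
  have s: "s \<le> 1 / 2" "s \<le> (p - 1) / 2" unfolding s_def by (rule min.cobounded1 min.cobounded2)+
  then have s1: "s \<le> 1" by linarith
  define W where "W j = 1 + log_plus (1 / measure sphere_measure (B j)) powr \<beta>" for j
  have W: "W j \<ge> 1" for j by (simp add: W_def)
  have b: "\<And>j. is_cap (B j)" "\<And>j. normalized_block sphere_measure p (B j) (a j)"
    and sm: "summable (\<lambda>j. cmod (\<mu> j) * W j)"
    using f unfolding block_series_def W_def by blast+
  have [measurable]: "f \<in> borel_measurable sphere_measure" "\<And>j. a j \<in> borel_measurable sphere_measure"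
    using f by (auto simp: block_series_def normalized_block_def)
  have tp: "t powr r \<le> t powr s" if "s \<le> r" for r using t that by (intro powr_mono') auto
  have one: "(\<integral>\<^sup>+ x. ennreal (cmod (a j x)) * indicator E x \<partial>sphere_measure) \<le> ennreal (6 * t powr s * W j)" for j
  proof -
    define m where "m = measure sphere_measure (B j)"
    have m: "m > 0" using sphere_measure_cap_pos[OF b(1)] by (simp add: m_def)
    show ?thesis
    proof (cases "m \<ge> exp (- ((1 / t) powr (1 / \<beta>)))")
      case True
      define l where "l = t powr - (1 / 2)"
      have l: "l > 0" using t by (simp add: l_def)
      have "(\<integral>\<^sup>+ x. ennreal (cmod (a j x)) * indicator E x \<partial>sphere_measure) \<le>
          ennreal (l * measure sphere_measure (E \<inter> B j) / m + l powr (1 - p))"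
        unfolding m_def using b p E l by (intro sphere.nn_integral_normalized_block_on) auto
      also have "\<dots> \<le> ennreal (6 * t powr s * W j)"
      proof (rule ennreal_leI)
        have "l * measure sphere_measure (E \<inter> B j) / m \<le> l * (3 * t * m) / m"
          using spread[OF b(1)[of j]] True m l
          by (intro divide_right_mono mult_left_mono) (auto simp: m_def)
        also have "\<dots> = 3 * (t powr - (1 / 2) * t powr 1)" using m t by (simp add: l_def)
        also have "t powr - (1 / 2) * t powr 1 = t powr (1 / 2)" unfolding powr_add[symmetric] by simp
        also have "3 * t powr (1 / 2) \<le> 3 * t powr s" using tp[OF s(1)] by simp
        finally have 1: "l * measure sphere_measure (E \<inter> B j) / m \<le> 3 * t powr s" .
        have "l powr (1 - p) = t powr ((p - 1) / 2)"
          unfolding l_def powr_powr by (rule arg_cong[where f = "(powr) t"]) (simp add: field_simps)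
        then have 2: "l powr (1 - p) \<le> t powr s" using tp[OF s(2)] by simp
        have "6 * t powr s * 1 \<le> 6 * t powr s * W j" using W by (intro mult_left_mono) auto
        then show "l * measure sphere_measure (E \<inter> B j) / m + l powr (1 - p) \<le> 6 * t powr s * W j"
          using 1 2 powr_ge_zero[of t s] by linarith
      qed
      finally show ?thesis .
    next
      case False
      \<comment> \<open>The threshold for small caps is \<open>exp (- y)\<close>, so that below it
        the weight is at least y^\<beta> = 1/t.\<close>
      define y where "y = (1 / t) powr (1 / \<beta>)"
      have y: "y \<ge> 0" by (simp add: y_def)
      have "exp y \<le> 1 / m"
        using False m by (simp add: y_def exp_minus field_simps)
      then have "y \<le> ln (1 / m)" using m by (subst ln_ge_iff) auto
      then have "y \<le> log_plus (1 / m)" using m by (auto simp: log_plus_def)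
      then have "y powr \<beta> \<le> W j"
        using \<beta> y powr_mono2[of \<beta> y "log_plus (1 / m)"] by (simp add: W_def m_def)
      then have "1 / t \<le> W j" using \<beta> t by (simp add: y_def powr_powr)
      \<comment> \<open>Since t W >= 1 and s <= 1, the entire mass 2 of the block is covered by 6
        t^s W.\<close>
      then have "1 \<le> t powr 1 * W j" using t by (simp add: field_simps)
      also have "\<dots> \<le> t powr s * W j" using tp[OF s1] W[of j] by (intro mult_right_mono) auto
      finally have "2 \<le> 6 * t powr s * W j" unfolding mult.assoc by linarith
      have "(\<integral>\<^sup>+ x. ennreal (cmod (a j x)) * indicator E x \<partial>sphere_measure) \<le>
          (\<integral>\<^sup>+ x. ennreal (cmod (a j x)) \<partial>sphere_measure)"
        by (intro nn_integral_mono) (auto simp: indicator_def)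
      also have "\<dots> \<le> ennreal 2" using sphere.nn_integral_normalized_block[OF b(2) p] by simp
      also have "\<dots> \<le> ennreal (6 * t powr s * W j)" by (intro ennreal_leI) fact
      finally show ?thesis .
    qed
  qed
  have "(\<integral>\<^sup>+ x. ennreal (cmod (f x)) * indicator E x \<partial>sphere_measure) \<le>
      (\<integral>\<^sup>+ x. (\<Sum>j. ennreal (cmod (\<mu> j)) * (ennreal (cmod (a j x)) * indicator E x)) \<partial>sphere_measure)"
  proof (rule nn_integral_mono_AE)
    show "AE x in sphere_measure. ennreal (cmod (f x)) * indicator E x \<le>
        (\<Sum>j. ennreal (cmod (\<mu> j)) * (ennreal (cmod (a j x)) * indicator E x))"
      using block_series_dominated[OF f]
      by eventually_elim (auto simp: indicator_def ennreal_mult)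
  qed
  also have "\<dots> = (\<Sum>j. ennreal (cmod (\<mu> j)) * (\<integral>\<^sup>+ x. ennreal (cmod (a j x)) * indicator E x \<partial>sphere_measure))"
    using E by (simp add: nn_integral_suminf nn_integral_cmult)
  also have "\<dots> \<le> (\<Sum>j. ennreal (6 * t powr s * (cmod (\<mu> j) * W j)))"
  proof (rule suminf_le)
    fix j
    have "ennreal (cmod (\<mu> j)) * (\<integral>\<^sup>+ x. ennreal (cmod (a j x)) * indicator E x \<partial>sphere_measure) \<le>
        ennreal (cmod (\<mu> j)) * ennreal (6 * t powr s * W j)"
      using one by (intro mult_left_mono) auto
    also have "\<dots> = ennreal (cmod (\<mu> j) * (6 * t powr s * W j))"
      using W[of j] by (intro ennreal_mult[symmetric]) auto
    also have "cmod (\<mu> j) * (6 * t powr s * W j) = 6 * t powr s * (cmod (\<mu> j) * W j)" by simp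
    finally show "ennreal (cmod (\<mu> j)) * (\<integral>\<^sup>+ x. ennreal (cmod (a j x)) * indicator E x \<partial>sphere_measure) \<le>
        ennreal (6 * t powr s * (cmod (\<mu> j) * W j))" .
  qed auto
  also have "\<dots> = ennreal (\<Sum>j. 6 * t powr s * (cmod (\<mu> j) * W j))"
  proof (rule suminf_ennreal2)
    show "0 \<le> 6 * t powr s * (cmod (\<mu> j) * W j)" for j
      using W[of j] by (intro mult_nonneg_nonneg) auto
  qed (rule summable_mult[OF sm])
  also have "(\<Sum>j. 6 * t powr s * (cmod (\<mu> j) * W j)) = 6 * t powr s * (\<Sum>j. cmod (\<mu> j) * W j)"
    by (rule suminf_mult[OF sm])
  finally show ?thesis by (simp only: W_def s_def)
qed

lemma ex_L_log_L_not_block_series: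
  assumes n: "CARD('n) \<ge> 2" and \<beta>: "\<beta> > 0"
  shows "\<exists>f \<in> (L_log_L \<beta> :: (real ^ 'n \<Rightarrow> complex) set). \<forall>p>1. \<nexists>\<mu> a B. block_series p \<beta> f \<mu> a B"
proof -
  define S where "S = measure sphere_measure (sphere 0 1 :: (real ^ 'n) set)"
  have S: "S > 0"
  proof -
    have "is_cap (cap (axis undefined 1 :: real ^ 'n) 1)"
      by (auto simp: is_cap_def intro!: bexI exI)
    then have "0 < measure sphere_measure (cap (axis undefined 1 :: real ^ 'n) 1)"
      by (rule sphere_measure_cap_pos)
    also have "\<dots> \<le> S"
      unfolding S_def using sets.top[of "sphere_measure :: (real ^ 'n) measure"]
      by (intro sphere.finite_measure_mono) (auto simp: cap_def)
    finally show ?thesis .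
  qed
  define t where "t k = (2::real) powr - real k" for k :: nat
  have t: "0 < t k" "t k \<le> 1" for k
    using powr_mono[of "- real k" 0 "2::real"] by (auto simp: t_def)
  have "\<forall>k. \<exists>E. E \<in> sets (sphere_measure :: (real ^ 'n) measure) \<and>
      measure sphere_measure E = t k * S \<and>
      (\<forall>M. is_cap M \<and> measure sphere_measure M \<ge> exp (- ((1 / t k) powr (1 / \<beta>))) \<longrightarrow>
        measure sphere_measure (E \<inter> M) \<le> 3 * t k * measure sphere_measure M)"
    using ex_spread_subset[OF n t exp_gt_zero] unfolding S_def by blast
  from choice[OF this] obtain E where E: "\<And>k. E k \<in> sets (sphere_measure :: (real ^ 'n) measure)"
    and ES: "\<And>k. measure sphere_measure (E k) = t k * S"
    and spread: "\<And>k M. is_cap M \<Longrightarrow> measure sphere_measure M \<ge> exp (- ((1 / t k) powr (1 / \<beta>))) \<Longrightarrow>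
        measure sphere_measure (E k \<inter> M) \<le> 3 * t k * measure sphere_measure M" by blast
  define e where "e k = measure sphere_measure (E k)" for k
  have e: "e k > 0" for k using t S by (simp add: e_def ES)
  define w where "w k = 1 + log_plus (1 / e k) powr \<beta>" for k
  have w: "w k \<ge> 1" for k by (simp add: w_def)
  \<comment> \<open>Makes c_k w_k = (1 + k)^(-2) summable, while \<open>c k\<close> decays only
    polynomially because \<open>w k\<close> grows at most like k^\<beta>.\<close>
  define c where "c k = 1 / ((1 + real k) powr 2 * w k)" for k
  have c: "c k > 0" for k using w[of k] by (simp add: c_def)
  have cw: "c k * w k = 1 / (1 + real k) powr 2" for k using w[of k] by (simp add: c_def)
  have sq: "summable (\<lambda>k. 1 / (1 + real k) powr 2)"
    using summable_Suc_iff[THEN iffD2, OF inverse_power_summable[of 2, where 'a = real]]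
    by (simp add: powr_realpow inverse_eq_divide add.commute)
  have scw: "summable (\<lambda>k. c k * w k)" using sq by (simp add: cw)
  have sc: "summable c"
  proof (rule summable_comparison_test'[OF scw])
    show "norm (c k) \<le> c k * w k" for k
      using mult_left_mono[OF w[of k], of "c k"] c[of k] by simp
  qed
  define a where "a k = (\<lambda>x. complex_of_real (indicator (E k) x / e k))" for k
  have cma: "cmod (a k x) = indicator (E k) x / e k" for k x
    using e[of k] by (simp add: a_def norm_divide)
  define F where "F x = (\<Sum>k. ennreal (c k * cmod (a k x)))" for x
  have am [measurable]: "a k \<in> borel_measurable sphere_measure" for k
    unfolding a_def using E[of k] by measurable
  have Fm [measurable]: "F \<in> borel_measurable sphere_measure" unfolding F_def by measurable
  have inta: "(\<integral>\<^sup>+ x. ennreal (c k * cmod (a k x)) \<partial>sphere_measure) = ennreal (c k)" for k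
  proof -
    have "(\<integral>\<^sup>+ x. ennreal (c k * cmod (a k x)) \<partial>sphere_measure) =
        (\<integral>\<^sup>+ x. ennreal (c k / e k) * indicator (E k) x \<partial>sphere_measure)"
      by (intro nn_integral_cong) (auto simp: cma indicator_def)
    also have "\<dots> = ennreal (c k / e k) * ennreal (e k)"
      using E[of k] by (simp add: nn_integral_cmult_indicator sphere.emeasure_eq_measure e_def)
    also have "\<dots> = ennreal (c k)" using c[of k] e[of k] by (simp flip: ennreal_mult)
    finally show ?thesis .
  qed
  have intF: "(\<integral>\<^sup>+ x. F x \<partial>sphere_measure) < \<infinity>"
  proof -
    have "(\<integral>\<^sup>+ x. F x \<partial>sphere_measure) = (\<Sum>k. ennreal (c k))"
      unfolding F_def by (subst nn_integral_suminf) (auto simp: inta)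
    also have "\<dots> = ennreal (suminf c)" using c sc by (intro suminf_ennreal2) (auto intro: less_imp_le)
    finally show ?thesis by simp
  qed
  then have "AE x in sphere_measure. F x \<noteq> \<infinity>"
    using Fm by (intro nn_integral_PInf_AE) (auto simp: less_top)
  \<comment> \<open>\<open>F\<close> may be infinite on a null set, where \<open>enn2real\<close>
    returns 0.\<close>
  define f where "f x = complex_of_real (enn2real (F x))" for x
  have fF: "AE x in sphere_measure. ennreal (cmod (f x)) = F x"
    using \<open>AE x in sphere_measure. F x \<noteq> \<infinity>\<close>
    by eventually_elim (simp add: f_def ennreal_enn2real less_top)
  have fm [measurable]: "f \<in> borel_measurable sphere_measure" unfolding f_def by measurable
  have "(\<integral>\<^sup>+ x. ennreal (cmod (f x)) \<partial>sphere_measure) = (\<integral>\<^sup>+ x. F x \<partial>sphere_measure)"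
    by (rule nn_integral_cong_AE[OF fF])
  then have intf: "integrable sphere_measure f"
    using intF by (simp add: integrable_iff_bounded)
  \<comment> \<open>e_k |a_k| is the indicator of \<open>E k\<close>, so any exponent above 1 would
    serve as well as 2.\<close>
  have blk: "normalized_block sphere_measure 2 (E k) (a k)" for k
  proof -
    have "(\<integral>\<^sup>+ x. ennreal ((e k * cmod (a k x)) powr 2) \<partial>sphere_measure) =
        (\<integral>\<^sup>+ x. indicator (E k) x \<partial>sphere_measure)"
      using e[of k] by (intro nn_integral_cong) (auto simp: cma indicator_def)
    also have "\<dots> = ennreal (e k)" using E[of k] by (simp add: sphere.emeasure_eq_measure e_def)
    finally show ?thesis
      using E[of k] e[of k] am[of k] by (auto simp: normalized_block_def e_def a_def)
  qed
  have "(\<integral>\<^sup>+ x. ennreal (cmod (f x) * log_plus (cmod (f x)) powr \<beta>) \<partial>sphere_measure) < \<infinity>"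
  proof (rule sphere.nn_integral_log_plus_powr_finite[OF \<beta> _ intf blk, where \<mu> = "\<lambda>k. complex_of_real (c k)"])
    show "AE x in sphere_measure. ennreal (cmod (f x)) \<le> (\<Sum>k. ennreal (cmod (complex_of_real (c k)) * cmod (a k x)))"
      using fF c by (auto elim!: eventually_mono simp: F_def less_imp_le)
    show "summable (\<lambda>k. cmod (complex_of_real (c k)) * (1 + log_plus (1 / measure sphere_measure (E k)) powr \<beta>))"
      using scw c by (simp add: w_def e_def less_imp_le)
  qed simp
  then have "f \<in> L_log_L \<beta>" using intf by (simp add: L_log_L_def)
  moreover have False if p: "p > 1" and series: "block_series p \<beta> f \<mu> b B" for p \<mu> b B
  proof -
    define s where "s = min (1 / 2) ((p - 1) / 2)"
    have s: "s > 0" using p by (simp add: s_def)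
    define D where "D = (\<Sum>j. cmod (\<mu> j) * (1 + log_plus (1 / measure sphere_measure (B j)) powr \<beta>))"
    have D: "D \<ge> 0"
      using series unfolding D_def block_series_def by (intro suminf_nonneg) auto
    \<comment> \<open>All terms of \<open>F\<close> are nonnegative, so nothing cancels where the
      sets overlap: the integral over \<open>E k\<close> is at least that of the k-th term, which is
      \<open>c k\<close>.\<close>
    have cD: "c k \<le> 6 * D * t k powr s" for k
    proof -
      have "ennreal (c k) = (\<integral>\<^sup>+ x. ennreal (c k * cmod (a k x)) * indicator (E k) x \<partial>sphere_measure)"
        unfolding inta[of k, symmetric] by (intro nn_integral_cong) (auto simp: cma indicator_def)
      also have "\<dots> \<le> (\<integral>\<^sup>+ x. ennreal (cmod (f x)) * indicator (E k) x \<partial>sphere_measure)"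
      proof (rule nn_integral_mono_AE)
        show "AE x in sphere_measure. ennreal (c k * cmod (a k x)) * indicator (E k) x \<le>
            ennreal (cmod (f x)) * indicator (E k) x"
          using fF
        proof eventually_elim
          case (elim x)
          have "ennreal (c k * cmod (a k x)) \<le> F x"
            unfolding F_def using sum_le_suminf[of "\<lambda>k. ennreal (c k * cmod (a k x))" "{k}"] by simp
          then show ?case unfolding elim by (intro mult_right_mono) auto
        qed
      qed
      also have "\<dots> \<le> ennreal (6 * t k powr s * D)"
        unfolding s_def D_def
        by (rule nn_integral_block_series_on_spread_set[OF series p \<beta> t E]) (rule spread)
      finally have "c k \<le> 6 * t k powr s * D"
        using D by (subst (asm) ennreal_le_iff) auto
      then show ?thesis by (simp add: mult_ac)
    qed
    \<comment> \<open>Absorbs the total measure of the sphere: log_plus (1/e_k) <= K (1 + k), using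
      ln 2 <= 1.\<close>
    define K where "K = log_plus (1 / S) + 1"
    have K: "K \<ge> 1" by (simp add: K_def)
    have wK: "w k \<le> (1 + K powr \<beta>) * (1 + real k) powr \<beta>" for k
    proof -
      have "1 / e k = 2 ^ k * (1 / S)" by (simp add: e_def ES t_def powr_minus powr_realpow field_simps)
      then have "log_plus (1 / e k) \<le> log_plus (2 ^ k) + log_plus (1 / S)"
        using log_plus_mult_le[of "2 ^ k" "1 / S"] S by simp
      also have "log_plus (2 ^ k) = real k * ln 2" by (simp add: log_plus_eq_ln ln_realpow)
      also have "\<dots> \<le> real k * 1" using ln_le_minus_one[of "2::real"] by (intro mult_left_mono) auto
      also have "real k * 1 \<le> real k * K" using K by (intro mult_left_mono) auto
      also have "real k * K + log_plus (1 / S) \<le> K * (1 + real k)" by (simp add: K_def algebra_simps)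
      finally have "log_plus (1 / e k) powr \<beta> \<le> (K * (1 + real k)) powr \<beta>"
        using \<beta> by (intro powr_mono2) auto
      also have "\<dots> = K powr \<beta> * (1 + real k) powr \<beta>" using K by (simp add: powr_mult)
      finally have "w k \<le> 1 + K powr \<beta> * (1 + real k) powr \<beta>" by (simp add: w_def)
      moreover have "1 \<le> (1 + real k) powr \<beta>" using \<beta> by (intro ge_one_powr_ge_zero) auto
      ultimately show ?thesis by (simp add: distrib_right)
    qed
    define C where "C = 6 * D * (1 + K powr \<beta>)"
    \<comment> \<open>Clearing the denominator of \<open>c k\<close> in \<open>cD\<close> bounds
      from below by 1 a sequence that tends to 0.\<close>
    have "1 \<le> C * (t k powr s * (1 + real k) powr (2 + \<beta>))" for k
    proof -
      have "1 = c k * ((1 + real k) powr 2 * w k)" using w[of k] by (simp add: c_def)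
      also have "\<dots> \<le> (6 * D * t k powr s) * ((1 + real k) powr 2 * ((1 + K powr \<beta>) * (1 + real k) powr \<beta>))"
        using cD[of k] wK[of k] w[of k] D by (intro mult_mono mult_left_mono) auto
      also have "\<dots> = C * (t k powr s * ((1 + real k) powr 2 * (1 + real k) powr \<beta>))"
        by (simp add: C_def mult_ac)
      also have "(1 + real k) powr 2 * (1 + real k) powr \<beta> = (1 + real k) powr (2 + \<beta>)"
        by (simp only: powr_add)
      finally show ?thesis .
    qed
    moreover have "(\<lambda>k. C * (t k powr s * (1 + real k) powr (2 + \<beta>))) \<longlonglongrightarrow> C * 0"
      unfolding t_def using s \<beta> by (intro tendsto_mult_left exponential_times_polynomial_tendsto_0) auto
    ultimately have "1 \<le> C * 0" using LIMSEQ_le_const by blast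
    then show False by simp
  qed
  ultimately show ?thesis by blast
qed

theorem mainTheorem4:
  fixes \<nu> :: real
  assumes "CARD('n::finite) \<ge> 2" and "\<nu> > - 1"
  shows "proper_subspace
    (\<Union>q\<in>{1<..\<infinity>}. block_space q \<nu> :: (real ^ 'n \<Rightarrow> complex) set)
    (L_log_L (1 + \<nu>))"
proof -
  have \<beta>: "1 + \<nu> > 0" using assms(2) by simp
  obtain f :: "real ^ 'n \<Rightarrow> complex"
    where "f \<in> L_log_L (1 + \<nu>)" "f \<notin> (\<Union>q\<in>{1<..\<infinity>}. block_space q \<nu>)"
    using ex_L_log_L_not_block_series[OF assms(1) \<beta>] unfolding block_union_iff by blast
  then show ?thesis
    unfolding proper_subspace_def
    using function_subspace_block_union function_subspace_L_log_L[OF \<beta>]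
      block_union_subset_L_log_L[OF assms(2)] by blast
qed

end
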